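(* Let $\pi$ be an $\mathcal{S}$-smooth spectral measure on $(\Sigma,\mathscr{A},\mu)$, and let $\Phi \in \mathcal{S}^*$ be integrable with respect to $\pi$. Suppose that $\Phi\geq 0$. Then, for all $\xi \in \mathcal{S}$, $$\Big\langle\!\Big\langle \Big(\int_{\Sigma} \Phi\, d\pi\Big)\overline{\xi},\ \xi\Big\rangle\!\Big\rangle \geq 0.$$
   Context: $\mathbb{N}=\{0,1,2,\dots\}$ and $\Gamma$ is the set of all finite subsets of $\mathbb{N}$. Bernoulli space: $\Sigma=\{-1,1\}^{\mathbb{N}}$, $\zeta_n(\omega)=\omega(n)$ for $\omega\in\Sigma$, $\mathscr{A}$ is the $\sigma$-field generated by $(\zeta_n)_{n\ge 0}$, $(\theta_n)_{n\ge0}$ is a given sequence with $0<\theta_n<1$, and $\mu$ is the unique probability measure on $\mathscr{A}$ under which the $\zeta_n$ are independent with $\mu(\zeta_n=1)=\theta_n$, $\mu(\zeta_n=-1)=1-\theta_n$. Put $Z_n=\frac{\zeta_n+1-2\theta_n}{2\sqrt{\theta_n(1-\theta_n)}}$, $Z_\emptyset=1$ and $Z_\sigma=\prod_{i\in\sigma}Z_i$ for nonempty $\sigma\in\Gamma$. $\mathcal{L}^2=\mathcal{L}^2(\Sigma,\mathscr{A},\mu)$ is the complex Hilbert space with inner product $\langle\xi,\eta\rangle=\int_\Sigma\overline{\xi}\eta\,d\mu$; $\{Z_\sigma\mid\sigma\in\Gamma\}$ is an orthonormal basis of $\mathcal{L}^2$. Define $\lambda_\emptyset=1$ and $\lambda_\sigma=\prod_{k\in\sigma}(1+k)$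 for nonempty $\sigma\in\Gamma$. For real $p\ge0$, $\mathcal{S}_p=\{\xi\in\mathcal{L}^2\mid \sum_{\sigma\in\Gamma}\lambda_\sigma^{2p}|\langle Z_\sigma,\xi\rangle|^2<\infty\}$, a Hilbert space with norm $\|\xi\|_p=\big(\sum_{\sigma\in\Gamma}\lambda_\sigma^{2p}|\langle Z_\sigma,\xi\rangle|^2\big)^{1/2}$. $\mathcal{S}=\bigcap_{p\ge0}\mathcal{S}_p$ carries the topology generated by the norms $\|\cdot\|_p$, $p\ge0$ (each $Z_\sigma\in\mathcal{S}$). $\mathcal{S}^*$ is the dual of $\mathcal{S}$ (continuous linear functionals) with the strong topology; its elements are called Bernoulli generalized functionals. The bilinear pairing on $\mathcal{S}^*\times\mathcal{S}$ is $\langle\!\langle\Phi,\xi\rangle\!\rangle=\Phi(\xi)$. $\overline{\xi}$ denotes the pointwise complex conjugate of $\xi$. $\mathfrak{L}(\mathcal{S},\mathcal{S}^* )$ is the space of continuous linear operators from $\mathcal{S}$ to $\mathcal{S}^*$. The 2D-Fock transform of $\mathsf{T}\colon\mathcal{S}\to\mathcal{S}^*$ is $\widehat{\mathsf{T}}(\sigma,\tau)=\langle\!\langle\mathsf{T}Z_\sigma,Z_\tau\rangle\!\rangle$, $\sigma,\tau\in\Gamma$. Known fact: elements of $\mathfrak{L}(\mathcal{S},\mathcal{S}^* )$ are determined by their 2D-Fock transforms, and a function $G$ on $\Gamma\times\Gamma$ is the 2D-Fock transform of some $\mathsf{T}\in\mathfrak{L}(\mathcal{S},\mathcal{S}^*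 )$ if and only if $|G(\sigma,\tau)|\le C\lambda_\sigma^p\lambda_\tau^p$ for all $\sigma,\tau\in\Gamma$, for some constants $C,p\ge0$. $\mathfrak{P}(\mathcal{L}^2)$ is the set of orthogonal projection operators on $\mathcal{L}^2$. A mapping $\pi\colon\mathscr{A}\to\mathfrak{P}(\mathcal{L}^2)$ is a spectral measure on $(\Sigma,\mathscr{A},\mu)$ if $\pi(\Sigma)=I$ and $\pi(\bigcup_{n\ge1}E_n)=\sum_{n\ge1}\pi(E_n)$, with convergence in the strong operator topology, for every sequence $(E_n)_{n\ge1}\subset\mathscr{A}$ of pairwise disjoint sets. It is $\mathcal{S}$-smooth if for each $(\sigma,\tau)\in\Gamma\times\Gamma$ there exists $\phi_{\sigma,\tau}^{\pi}\in\mathcal{S}$ (the numerical spectral density of $\pi$ associated with $(\sigma,\tau)$) such that $\langle\pi(E)Z_\sigma,Z_\tau\rangle=\int_E\phi_{\sigma,\tau}^{\pi}\,d\mu$ for all $E\in\mathscr{A}$. For an $\mathcal{S}$-smooth spectral measure $\pi$, $\Phi\in\mathcal{S}^*$ is integrable with respect to $\pi$ if there exist constants $C\ge0$, $p\ge0$ such that $|\langle\!\langle\Phi,\phi_{\sigma,\tau}^{\pi}\rangle\!\rangle|\le C\lambda_\sigma^p\lambda_\tau^p$ for all $(\sigma,\tau)\in\Gamma\times\Gamma$. In that case the spectral integral $\int_\Sigma\Phi\,d\pi$ is the unique operator in $\mathfrak{L}(\mathcal{S},\mathcal{S}^* )$ whose 2D-Fock transform is $(\sigma,\tau)\mapsto\langle\!\langle\Phi,\phi_{\sigma,\tau}^{\pi}\rangle\!\rangle$.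 Positivity: for $\xi\in\mathcal{S}$, $\xi\ge0$ means $\xi(\omega)\ge0$ for $\mu$-almost all $\omega\in\Sigma$; for $\Phi\in\mathcal{S}^*$, $\Phi\ge0$ means $\langle\!\langle\Phi,\xi\rangle\!\rangle\ge0$ for all $\xi\in\mathcal{S}$ with $\xi\ge0$. *)

theory Defs
  imports "HOL-Probability.Probability"
begin

text \<open>
  The sample space is \<open>{-1, 1}\<close> to the power of the naturals, realised as the functions
  \<open>nat \<Rightarrow> real\<close> with values in \<open>{-1, 1}\<close>; the coordinate \<open>\<omega> n\<close> is the random variable
  usually written \<open>\<zeta>\<^sub>n(\<omega>)\<close>.
  The lemmas \<open>bernoulli_properties\<close> and \<open>bernoulli_unique\<close> below show that this product measure
  is the unique probability measure on the \<open>\<sigma>\<close>-field generated by the coordinates that makes them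
  independent with the prescribed laws.
\<close>

definition coin :: "real \<Rightarrow> real measure" where
  "coin t = point_measure {-1, 1} (\<lambda>x. ennreal (if x = 1 then t else 1 - t))"

definition bernoulli :: "(nat \<Rightarrow> real) \<Rightarrow> (nat \<Rightarrow> real) measure" where
  "bernoulli \<theta> = (\<Pi>\<^sub>M n\<in>UNIV. coin (\<theta> n))"

type_synonym cfun = "(nat \<Rightarrow> real) \<Rightarrow> complex"

lemma space_coin [simp]: "space (coin t) = {-1, 1}"
  by (simp add: coin_def space_point_measure)

lemma sets_coin [simp]: "sets (coin t) = Pow {-1, 1}"
  by (simp add: coin_def sets_point_measure)

lemma emeasure_coin:
  assumes "A \<subseteq> {-1, 1}"
  shows "emeasure (coin t) A = (\<Sum>x\<in>A. ennreal (if x = 1 then t else 1 - t))"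
  using assms by (simp add: coin_def emeasure_point_measure_finite)

lemma prob_space_coin:
  assumes "0 < t" "t < 1"
  shows "prob_space (coin t)"
  using assms
  by (intro prob_spaceI) (simp add: emeasure_coin flip: ennreal_plus)

lemma prob_space_bernoulli:
  assumes "\<And>n. 0 < \<theta> n \<and> \<theta> n < 1"
  shows "prob_space (bernoulli \<theta>)"
  unfolding bernoulli_def using assms by (intro prob_space_PiM prob_space_coin) auto

lemma space_bernoulli: "space (bernoulli \<theta>) = {\<omega>. \<forall>n. \<omega> n \<in> {-1, 1}}"
  by (auto simp: bernoulli_def space_PiM PiE_def Pi_def)

lemma sets_bernoulli:
  "sets (bernoulli \<theta>) =
     sigma_sets (space (bernoulli \<theta>)) {{\<omega> \<in> space (bernoulli \<theta>). \<omega> n \<in> A} | n A. A \<subseteq> {-1, 1}}"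
  by (auto simp: bernoulli_def sets_PiM_single space_PiM intro!: arg_cong2[where f = sigma_sets])

lemma measurable_coordinate:
  assumes "sets M = sets (bernoulli \<theta>)"
  shows "(\<lambda>\<omega>. \<omega> n) \<in> M \<rightarrow>\<^sub>M count_space {-1, 1}"
proof -
  have "(\<lambda>\<omega>. \<omega> n) \<in> bernoulli \<theta> \<rightarrow>\<^sub>M coin (\<theta> n)"
    unfolding bernoulli_def by (rule measurable_component_singleton) simp
  also have "bernoulli \<theta> \<rightarrow>\<^sub>M coin (\<theta> n) = M \<rightarrow>\<^sub>M count_space {-1, 1}"
    by (rule measurable_cong_sets) (simp_all add: assms)
  finally show ?thesis .
qed

lemma indep_coordinates_iff:
  assumes "prob_space M" "sets M = sets (bernoulli \<theta>)"
  shows "prob_space.indep_vars M (\<lambda>n. count_space {-1, 1}) (\<lambda>n \<omega>. \<omega> n) UNIV \<longleftrightarrow>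
    M = (\<Pi>\<^sub>M n\<in>UNIV. distr M (count_space {-1, 1}) (\<lambda>\<omega>. \<omega> n))"
proof -
  have "sets (\<Pi>\<^sub>M n\<in>UNIV. count_space {-1, 1 :: real}) = sets M"
    unfolding assms(2) bernoulli_def by (rule sets_PiM_cong) simp_all
  then have "distr M (\<Pi>\<^sub>M n\<in>UNIV. count_space {-1, 1}) (\<lambda>\<omega>. \<lambda>n\<in>UNIV. \<omega> n) = M"
    by (simp add: restrict_UNIV distr_id2)
  then show ?thesis
    using prob_space.indep_vars_iff_distr_eq_PiM'[OF assms(1), of UNIV "\<lambda>n \<omega>. \<omega> n"
        "\<lambda>n. count_space {-1, 1}"] measurable_coordinate[OF assms(2)]
    by simp
qed

lemma distr_coordinate:
  assumes "\<And>n. 0 < \<theta> n \<and> \<theta> n < 1"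
  shows "distr (bernoulli \<theta>) (count_space {-1, 1}) (\<lambda>\<omega>. \<omega> n) = coin (\<theta> n)"
proof -
  have "distr (bernoulli \<theta>) (count_space {-1, 1}) (\<lambda>\<omega>. \<omega> n) =
      distr (bernoulli \<theta>) (coin (\<theta> n)) (\<lambda>\<omega>. \<omega> n)"
    by (rule distr_cong) simp_all
  also have "\<dots> = coin (\<theta> n)"
    unfolding bernoulli_def by (rule distr_PiM_component) (use assms in \<open>auto intro: prob_space_coin\<close>)
  finally show ?thesis .
qed

lemma bernoulli_properties:
  assumes \<theta>: "\<And>n. 0 < \<theta> n \<and> \<theta> n < 1"
  shows "prob_space.indep_vars (bernoulli \<theta>) (\<lambda>n. count_space {-1, 1}) (\<lambda>n \<omega>. \<omega> n) UNIV"
    and "measure (bernoulli \<theta>) {\<omega> \<in> space (bernoulli \<theta>). \<omega> n = 1} = \<theta> n"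
    and "measure (bernoulli \<theta>) {\<omega> \<in> space (bernoulli \<theta>). \<omega> n = -1} = 1 - \<theta> n"
proof -
  show "prob_space.indep_vars (bernoulli \<theta>) (\<lambda>n. count_space {-1, 1}) (\<lambda>n \<omega>. \<omega> n) UNIV"
    unfolding indep_coordinates_iff[OF prob_space_bernoulli[of \<theta>, OF \<theta>] refl]
      distr_coordinate[of \<theta>, OF \<theta>]
    by (simp add: bernoulli_def)
  have *: "measure (bernoulli \<theta>) {\<omega> \<in> space (bernoulli \<theta>). \<omega> n = x} = measure (coin (\<theta> n)) {x}"
    if "x \<in> {-1, 1}" for x
    unfolding distr_coordinate[of \<theta> n, OF \<theta>, symmetric]
    using that measurable_coordinate[of "bernoulli \<theta>" \<theta> n, OF refl]
    by (subst measure_distr) (auto intro!: arg_cong[where f = "measure (bernoulli \<theta>)"])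
  show "measure (bernoulli \<theta>) {\<omega> \<in> space (bernoulli \<theta>). \<omega> n = 1} = \<theta> n"
    and "measure (bernoulli \<theta>) {\<omega> \<in> space (bernoulli \<theta>). \<omega> n = -1} = 1 - \<theta> n"
    using \<theta>[of n] *[of 1] *[of "-1"]
    by (simp_all add: emeasure_coin Sigma_Algebra.measure_def[of "coin _"])
qed

lemma bernoulli_unique:
  assumes "prob_space M" "sets M = sets (bernoulli \<theta>)"
    and "prob_space.indep_vars M (\<lambda>n. count_space {-1, 1}) (\<lambda>n \<omega>. \<omega> n) UNIV"
    and "\<And>n. measure M {\<omega> \<in> space M. \<omega> n = 1} = \<theta> n"
    and "\<And>n. measure M {\<omega> \<in> space M. \<omega> n = -1} = 1 - \<theta> n"
  shows "M = bernoulli \<theta>"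
proof -
  interpret prob_space M by fact
  have "distr M (count_space {-1, 1}) (\<lambda>\<omega>. \<omega> n) = coin (\<theta> n)" for n
  proof (rule measure_eqI_finite)
    fix x :: real assume x: "x \<in> {-1, 1}"
    have "emeasure (distr M (count_space {-1, 1}) (\<lambda>\<omega>. \<omega> n)) {x} =
        emeasure M {\<omega> \<in> space M. \<omega> n = x}"
      using x measurable_coordinate[OF assms(2)]
      by (subst emeasure_distr) (auto intro!: arg_cong[where f = "emeasure M"])
    also have "\<dots> = emeasure (coin (\<theta> n)) {x}"
      using x assms(4,5)[of n] by (auto simp: emeasure_eq_measure emeasure_coin)
    finally show "emeasure (distr M (count_space {-1, 1}) (\<lambda>\<omega>. \<omega> n)) {x} =
        emeasure (coin (\<theta> n)) {x}" .
  qed simp_all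
  then show ?thesis
    using assms(3) indep_coordinates_iff[OF assms(1,2)] by (simp add: bernoulli_def)
qed

text \<open>
  Elements of the Hilbert space are handled through representatives: square-integrable functions,
  two of them being identified when they are equal almost everywhere.
\<close>

definition L2 :: "(nat \<Rightarrow> real) measure \<Rightarrow> cfun set" where
  "L2 M = {f \<in> borel_measurable M. integrable M (\<lambda>\<omega>. (cmod (f \<omega>))\<^sup>2)}"

definition ip :: "(nat \<Rightarrow> real) measure \<Rightarrow> cfun \<Rightarrow> cfun \<Rightarrow> complex" where
  "ip M f g = (LINT \<omega>|M. cnj (f \<omega>) * g \<omega>)"

definition L2_norm :: "(nat \<Rightarrow> real) measure \<Rightarrow> cfun \<Rightarrow> real" where
  "L2_norm M f = sqrt (LINT \<omega>|M. (cmod (f \<omega>))\<^sup>2)"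

definition ae_eq :: "(nat \<Rightarrow> real) measure \<Rightarrow> cfun \<Rightarrow> cfun \<Rightarrow> bool" where
  "ae_eq M f g \<longleftrightarrow> (AE \<omega> in M. f \<omega> = g \<omega>)"

text \<open>
  An operator on the Hilbert space is a map on representatives that is compatible with
  almost-everywhere equality.
\<close>

definition bounded_operator :: "(nat \<Rightarrow> real) measure \<Rightarrow> (cfun \<Rightarrow> cfun) \<Rightarrow> bool" where
  "bounded_operator M P \<longleftrightarrow>
     (\<forall>f\<in>L2 M. P f \<in> L2 M) \<and>
     (\<forall>f\<in>L2 M. \<forall>g\<in>L2 M. ae_eq M f g \<longrightarrow> ae_eq M (P f) (P g)) \<and>
     (\<forall>f\<in>L2 M. \<forall>g\<in>L2 M. ae_eq M (P (\<lambda>\<omega>. f \<omega> + g \<omega>)) (\<lambda>\<omega>. P f \<omega> + P g \<omega>)) \<and>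
     (\<forall>f\<in>L2 M. \<forall>c. ae_eq M (P (\<lambda>\<omega>. c * f \<omega>)) (\<lambda>\<omega>. c * P f \<omega>)) \<and>
     (\<exists>K. \<forall>f\<in>L2 M. L2_norm M (P f) \<le> K * L2_norm M f)"

definition orthogonal_projection :: "(nat \<Rightarrow> real) measure \<Rightarrow> (cfun \<Rightarrow> cfun) \<Rightarrow> bool" where
  "orthogonal_projection M P \<longleftrightarrow>
     bounded_operator M P \<and>
     (\<forall>f\<in>L2 M. ae_eq M (P (P f)) (P f)) \<and>
     (\<forall>f\<in>L2 M. \<forall>g\<in>L2 M. ip M (P f) g = ip M f (P g))"

text \<open>The last clause is countable additivity in the strong operator topology.\<close>

definition spectral_measure ::
    "(nat \<Rightarrow> real) measure \<Rightarrow> ((nat \<Rightarrow> real) set \<Rightarrow> cfun \<Rightarrow> cfun) \<Rightarrow> bool" where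
  "spectral_measure M \<pi> \<longleftrightarrow>
     (\<forall>E\<in>sets M. orthogonal_projection M (\<pi> E)) \<and>
     (\<forall>f\<in>L2 M. ae_eq M (\<pi> (space M) f) f) \<and>
     (\<forall>E :: nat \<Rightarrow> (nat \<Rightarrow> real) set. range E \<subseteq> sets M \<longrightarrow> disjoint_family E \<longrightarrow>
        (\<forall>f\<in>L2 M.
           (\<lambda>N. L2_norm M (\<lambda>\<omega>. (\<Sum>n<N. \<pi> (E n) f \<omega>) - \<pi> (\<Union>n. E n) f \<omega>)) \<longlonglongrightarrow> 0))"

text \<open>Finite sets \<open>\<sigma>\<close> of naturals serve as indices; products over the empty set are \<open>1\<close>.\<close>

definition Z :: "(nat \<Rightarrow> real) \<Rightarrow> nat set \<Rightarrow> cfun" where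
  "Z \<theta> \<sigma> = (\<lambda>\<omega>. \<Prod>i\<in>\<sigma>.
     complex_of_real ((\<omega> i + 1 - 2 * \<theta> i) / (2 * sqrt (\<theta> i * (1 - \<theta> i)))))"

definition lam :: "nat set \<Rightarrow> real" where
  "lam \<sigma> = (\<Prod>k\<in>\<sigma>. 1 + real k)"

definition S_weight :: "(nat \<Rightarrow> real) \<Rightarrow> real \<Rightarrow> cfun \<Rightarrow> nat set \<Rightarrow> real" where
  "S_weight \<theta> p \<xi> \<sigma> = lam \<sigma> powr (2 * p) * (cmod (ip (bernoulli \<theta>) (Z \<theta> \<sigma>) \<xi>))\<^sup>2"

definition S_level :: "(nat \<Rightarrow> real) \<Rightarrow> real \<Rightarrow> cfun set" where
  "S_level \<theta> p = {\<xi> \<in> L2 (bernoulli \<theta>). S_weight \<theta> p \<xi> summable_on {\<sigma>. finite \<sigma>}}"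

definition S_norm :: "(nat \<Rightarrow> real) \<Rightarrow> real \<Rightarrow> cfun \<Rightarrow> real" where
  "S_norm \<theta> p \<xi> = sqrt (\<Sum>\<^sub>\<infinity>\<sigma>\<in>{\<sigma>. finite \<sigma>}. S_weight \<theta> p \<xi> \<sigma>)"

definition S_space :: "(nat \<Rightarrow> real) \<Rightarrow> cfun set" where
  "S_space \<theta> = (\<Inter>p\<in>{0..}. S_level \<theta> p)"

definition S_topology :: "(nat \<Rightarrow> real) \<Rightarrow> cfun topology" where
  "S_topology \<theta> = topology_generated_by
     {{\<eta> \<in> S_space \<theta>. S_norm \<theta> p (\<lambda>\<omega>. \<eta> \<omega> - \<xi> \<omega>) < r} | \<xi> p r. \<xi> \<in> S_space \<theta> \<and> 0 \<le> p \<and> 0 < r}"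

text \<open>
  Functionals on \<open>S_space\<close> are represented extensionally, i.e. they are \<open>undefined\<close> outside it, so
  that equality of functionals is HOL equality. A continuous linear functional takes the same value
  on functions that are equal almost everywhere, since these are topologically indistinguishable.
\<close>

definition S_dual :: "(nat \<Rightarrow> real) \<Rightarrow> (cfun \<Rightarrow> complex) set" where
  "S_dual \<theta> = {\<Phi> \<in> extensional (S_space \<theta>).
     (\<forall>\<xi>\<in>S_space \<theta>. \<forall>\<eta>\<in>S_space \<theta>. \<Phi> (\<lambda>\<omega>. \<xi> \<omega> + \<eta> \<omega>) = \<Phi> \<xi> + \<Phi> \<eta>) \<and>
     (\<forall>\<xi>\<in>S_space \<theta>. \<forall>c. \<Phi> (\<lambda>\<omega>. c * \<xi> \<omega>) = c * \<Phi> \<xi>) \<and>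
     continuous_map (S_topology \<theta>) euclidean \<Phi>}"

definition S_bounded :: "(nat \<Rightarrow> real) \<Rightarrow> cfun set \<Rightarrow> bool" where
  "S_bounded \<theta> B \<longleftrightarrow> B \<subseteq> S_space \<theta> \<and> (\<forall>p\<ge>0. bdd_above (S_norm \<theta> p ` B))"

text \<open>The strong topology: uniform convergence on bounded sets.\<close>

definition S_dual_topology :: "(nat \<Rightarrow> real) \<Rightarrow> (cfun \<Rightarrow> complex) topology" where
  "S_dual_topology \<theta> = topology_generated_by
     {{\<Psi> \<in> S_dual \<theta>. (SUP \<xi>\<in>B. cmod (\<Psi> \<xi> - \<Phi> \<xi>)) < r} | \<Phi> B r.
        \<Phi> \<in> S_dual \<theta> \<and> S_bounded \<theta> B \<and> B \<noteq> {} \<and> 0 < r}"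

definition S_operators :: "(nat \<Rightarrow> real) \<Rightarrow> (cfun \<Rightarrow> cfun \<Rightarrow> complex) set" where
  "S_operators \<theta> = {T \<in> S_space \<theta> \<rightarrow>\<^sub>E S_dual \<theta>.
     (\<forall>\<xi>\<in>S_space \<theta>. \<forall>\<eta>\<in>S_space \<theta>. \<forall>\<zeta>\<in>S_space \<theta>.
        T (\<lambda>\<omega>. \<xi> \<omega> + \<eta> \<omega>) \<zeta> = T \<xi> \<zeta> + T \<eta> \<zeta>) \<and>
     (\<forall>\<xi>\<in>S_space \<theta>. \<forall>\<zeta>\<in>S_space \<theta>. \<forall>c. T (\<lambda>\<omega>. c * \<xi> \<omega>) \<zeta> = c * T \<xi> \<zeta>) \<and>
     continuous_map (S_topology \<theta>) (S_dual_topology \<theta>) T}"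

definition fock_transform ::
    "(nat \<Rightarrow> real) \<Rightarrow> (cfun \<Rightarrow> cfun \<Rightarrow> complex) \<Rightarrow> nat set \<Rightarrow> nat set \<Rightarrow> complex" where
  "fock_transform \<theta> T \<sigma> \<tau> = T (Z \<theta> \<sigma>) (Z \<theta> \<tau>)"

definition is_spectral_density :: "(nat \<Rightarrow> real) \<Rightarrow> ((nat \<Rightarrow> real) set \<Rightarrow> cfun \<Rightarrow> cfun) \<Rightarrow>
    nat set \<Rightarrow> nat set \<Rightarrow> cfun \<Rightarrow> bool" where
  "is_spectral_density \<theta> \<pi> \<sigma> \<tau> \<phi> \<longleftrightarrow> \<phi> \<in> S_space \<theta> \<and>
     (\<forall>E\<in>sets (bernoulli \<theta>).
        ip (bernoulli \<theta>) (\<pi> E (Z \<theta> \<sigma>)) (Z \<theta> \<tau>) = (LINT \<omega>:E|bernoulli \<theta>. \<phi> \<omega>))"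

definition S_smooth :: "(nat \<Rightarrow> real) \<Rightarrow> ((nat \<Rightarrow> real) set \<Rightarrow> cfun \<Rightarrow> cfun) \<Rightarrow> bool" where
  "S_smooth \<theta> \<pi> \<longleftrightarrow> spectral_measure (bernoulli \<theta>) \<pi> \<and>
     (\<forall>\<sigma> \<tau>. finite \<sigma> \<longrightarrow> finite \<tau> \<longrightarrow> (\<exists>\<phi>. is_spectral_density \<theta> \<pi> \<sigma> \<tau> \<phi>))"

text \<open>
  The density is unique only up to almost-everywhere equality, so a representative is chosen; the
  value of an element of \<open>S_dual\<close> on it does not depend on the choice.
\<close>

definition spectral_density :: "(nat \<Rightarrow> real) \<Rightarrow> ((nat \<Rightarrow> real) set \<Rightarrow> cfun \<Rightarrow> cfun) \<Rightarrow>
    nat set \<Rightarrow> nat set \<Rightarrow> cfun" where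
  "spectral_density \<theta> \<pi> \<sigma> \<tau> = (SOME \<phi>. is_spectral_density \<theta> \<pi> \<sigma> \<tau> \<phi>)"

definition spectral_integrable :: "(nat \<Rightarrow> real) \<Rightarrow> ((nat \<Rightarrow> real) set \<Rightarrow> cfun \<Rightarrow> cfun) \<Rightarrow>
    (cfun \<Rightarrow> complex) \<Rightarrow> bool" where
  "spectral_integrable \<theta> \<pi> \<Phi> \<longleftrightarrow> (\<exists>C\<ge>0. \<exists>p\<ge>0. \<forall>\<sigma> \<tau>. finite \<sigma> \<longrightarrow> finite \<tau> \<longrightarrow>
     cmod (\<Phi> (spectral_density \<theta> \<pi> \<sigma> \<tau>)) \<le> C * lam \<sigma> powr p * lam \<tau> powr p)"

definition spectral_integral :: "(nat \<Rightarrow> real) \<Rightarrow> ((nat \<Rightarrow> real) set \<Rightarrow> cfun \<Rightarrow> cfun) \<Rightarrow>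
    (cfun \<Rightarrow> complex) \<Rightarrow> cfun \<Rightarrow> cfun \<Rightarrow> complex" where
  "spectral_integral \<theta> \<pi> \<Phi> = (THE T. T \<in> S_operators \<theta> \<and>
     (\<forall>\<sigma> \<tau>. finite \<sigma> \<longrightarrow> finite \<tau> \<longrightarrow>
        fock_transform \<theta> T \<sigma> \<tau> = \<Phi> (spectral_density \<theta> \<pi> \<sigma> \<tau>)))"

definition nonneg_testfun :: "(nat \<Rightarrow> real) \<Rightarrow> cfun \<Rightarrow> bool" where
  "nonneg_testfun \<theta> \<xi> \<longleftrightarrow> (AE \<omega> in bernoulli \<theta>. \<xi> \<omega> \<in> \<real>\<^sub>\<ge>\<^sub>0)"

definition nonneg_functional :: "(nat \<Rightarrow> real) \<Rightarrow> (cfun \<Rightarrow> complex) \<Rightarrow> bool" where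
  "nonneg_functional \<theta> \<Phi> \<longleftrightarrow> (\<forall>\<xi>\<in>S_space \<theta>. nonneg_testfun \<theta> \<xi> \<longrightarrow> \<Phi> \<xi> \<in> \<real>\<^sub>\<ge>\<^sub>0)"

end

theory Submission
  imports Defs
begin

text \<open>
  Expanding continuous functionals and operators in the \<open>Z \<theta> \<sigma>\<close> shows that the spectral integral exists,
  is unique, and is given by the absolutely convergent form
  \<open>(\<xi>, \<eta>) \<mapsto> \<Sum>\<^sub>\<sigma>\<^sub>,\<^sub>\<tau> \<langle>Z\<^sub>\<sigma>, \<xi>\<rangle> \<langle>Z\<^sub>\<tau>, \<eta>\<rangle> \<Phi>(\<phi>\<^sub>\<sigma>\<^sub>\<tau>)\<close>. For a finite combination \<open>\<eta> = \<Sum> a\<^sub>\<sigma> Z\<^sub>\<sigma>\<close> the function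
  \<open>\<psi> = \<Sum> cnj(a\<^sub>\<sigma>) a\<^sub>\<tau> \<phi>\<^sub>\<sigma>\<^sub>\<tau>\<close> has integral \<open>\<langle>\<pi>(E) \<eta>, \<eta>\<rangle> = \<parallel>\<pi>(E) \<eta>\<parallel>\<^sup>2 \<ge> 0\<close> over every \<open>E\<close>, so \<open>\<psi> \<ge> 0\<close> almost
  everywhere and \<open>\<Phi>(\<psi>) \<ge> 0\<close>; the claim follows by letting \<open>\<eta>\<close> run through the partial sums of the
  expansion of \<open>\<xi>\<close>.
\<close>

section \<open>Square-integrable representatives and their inner product\<close>

lemma L2_integrable_mult:
  assumes "f \<in> L2 M" "g \<in> L2 M"
  shows "integrable M (\<lambda>\<omega>. cnj (f \<omega>) * g \<omega>)"
proof (rule Bochner_Integration.integrable_bound)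
  show "integrable M (\<lambda>\<omega>. (cmod (f \<omega>))\<^sup>2 + (cmod (g \<omega>))\<^sup>2)"
    using assms by (simp add: L2_def)
  have [measurable]: "f \<in> borel_measurable M" "g \<in> borel_measurable M"
    using assms by (simp_all add: L2_def)
  have [measurable]: "cnj \<in> borel_measurable borel"
    by (intro borel_measurable_continuous_onI continuous_intros)
  show "(\<lambda>\<omega>. cnj (f \<omega>) * g \<omega>) \<in> borel_measurable M"
    by measurable
  have "x * y \<le> x\<^sup>2 + y\<^sup>2" if "0 \<le> x" "0 \<le> y" for x y :: real
    using sum_squares_bound[of x y] that mult_nonneg_nonneg[OF that] by linarith
  then show "AE \<omega> in M. norm (cnj (f \<omega>) * g \<omega>) \<le> norm ((cmod (f \<omega>))\<^sup>2 + (cmod (g \<omega>))\<^sup>2)"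
    by (simp add: norm_mult)
qed

lemma L2_add:
  assumes "f \<in> L2 M" "g \<in> L2 M"
  shows "(\<lambda>\<omega>. f \<omega> + g \<omega>) \<in> L2 M"
proof -
  have [measurable]: "f \<in> borel_measurable M" "g \<in> borel_measurable M"
    using assms by (simp_all add: L2_def)
  have "integrable M (\<lambda>\<omega>. (cmod (f \<omega> + g \<omega>))\<^sup>2)"
  proof (rule Bochner_Integration.integrable_bound)
    show "integrable M (\<lambda>\<omega>. 2 * (cmod (f \<omega>))\<^sup>2 + 2 * (cmod (g \<omega>))\<^sup>2)"
      using assms by (simp add: L2_def)
    have "(cmod (a + b))\<^sup>2 \<le> 2 * (cmod a)\<^sup>2 + 2 * (cmod b)\<^sup>2" for a b
    proof -
      have "(cmod (a + b))\<^sup>2 \<le> (cmod a + cmod b)\<^sup>2"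
        by (intro power_mono norm_triangle_ineq) simp
      also have "\<dots> \<le> 2 * (cmod a)\<^sup>2 + 2 * (cmod b)\<^sup>2"
        using sum_squares_bound[of "cmod a" "cmod b"] by (simp add: power2_sum)
      finally show ?thesis .
    qed
    then show "AE \<omega> in M. norm ((cmod (f \<omega> + g \<omega>))\<^sup>2)
        \<le> norm (2 * (cmod (f \<omega>))\<^sup>2 + 2 * (cmod (g \<omega>))\<^sup>2)"
      by simp
  qed measurable
  then show ?thesis
    by (simp add: L2_def)
qed

lemma L2_scale: "f \<in> L2 M \<Longrightarrow> (\<lambda>\<omega>. c * f \<omega>) \<in> L2 M"
  by (auto simp: L2_def norm_mult power_mult_distrib)

lemma L2_cnj:
  assumes "f \<in> L2 M"
  shows "(\<lambda>\<omega>. cnj (f \<omega>)) \<in> L2 M"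
proof -
  have [measurable]: "cnj \<in> borel_measurable borel"
    by (intro borel_measurable_continuous_onI continuous_intros)
  have [measurable]: "f \<in> borel_measurable M"
    using assms by (simp add: L2_def)
  have "(\<lambda>\<omega>. cnj (f \<omega>)) \<in> borel_measurable M"
    by measurable
  with assms show ?thesis
    by (simp add: L2_def)
qed

lemma L2_zero: "(\<lambda>\<omega>. 0) \<in> L2 M"
  by (simp add: L2_def)

lemma L2_sum: "(\<And>i. i \<in> I \<Longrightarrow> f i \<in> L2 M) \<Longrightarrow> (\<lambda>\<omega>. \<Sum>i\<in>I. f i \<omega>) \<in> L2 M"
  by (induction I rule: infinite_finite_induct) (auto intro: L2_zero L2_add)

lemma ip_add_right:
  "\<lbrakk>f \<in> L2 M; g \<in> L2 M; h \<in> L2 M\<rbrakk> \<Longrightarrow> ip M f (\<lambda>\<omega>. g \<omega> + h \<omega>) = ip M f g + ip M f h"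
  using L2_integrable_mult[of f M g] L2_integrable_mult[of f M h]
  by (simp add: ip_def distrib_left)

lemma ip_scale_right: "ip M f (\<lambda>\<omega>. c * g \<omega>) = c * ip M f g"
  by (simp add: ip_def mult.left_commute)

lemma ip_sum_right:
  assumes "f \<in> L2 M" "\<And>i. i \<in> I \<Longrightarrow> g i \<in> L2 M"
  shows "ip M f (\<lambda>\<omega>. \<Sum>i\<in>I. g i \<omega>) = (\<Sum>i\<in>I. ip M f (g i))"
  using assms(2)
  by (induction I rule: infinite_finite_induct)
    (simp_all add: ip_add_right L2_sum assms(1), simp_all add: ip_def)

lemma cnj_ip: "cnj (ip M f g) = ip M g f"
  by (simp add: ip_def mult.commute flip: Bochner_Integration.integral_cnj)

lemma ip_scale_left: "ip M (\<lambda>\<omega>. c * g \<omega>) f = cnj c * ip M g f"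
  by (simp add: ip_def mult.assoc)

lemma ip_sum_left:
  assumes "f \<in> L2 M" "\<And>i. i \<in> I \<Longrightarrow> g i \<in> L2 M"
  shows "ip M (\<lambda>\<omega>. \<Sum>i\<in>I. g i \<omega>) f = (\<Sum>i\<in>I. ip M (g i) f)"
  using arg_cong[OF ip_sum_right[OF assms], where f = cnj] by (simp add: cnj_ip)

lemma ip_cong_left:
  assumes "ae_eq M f f'" "f \<in> L2 M" "f' \<in> L2 M" "g \<in> L2 M"
  shows "ip M f g = ip M f' g"
  unfolding ip_def
proof (rule integral_cong_AE)
  show "AE \<omega> in M. cnj (f \<omega>) * g \<omega> = cnj (f' \<omega>) * g \<omega>"
    using assms(1) unfolding ae_eq_def by eventually_elim simp
qed (use L2_integrable_mult assms in auto)

lemma ip_self_nonneg: "ip M f f \<in> \<real>\<^sub>\<ge>\<^sub>0"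
proof -
  have "ip M f f = complex_of_real (LINT \<omega>|M. (cmod (f \<omega>))\<^sup>2)"
    unfolding ip_def integral_complex_of_real[symmetric] complex_norm_square
    by (simp add: mult.commute)
  then show ?thesis
    by simp
qed

section \<open>Bounded operators and orthogonal projections\<close>

text \<open>Additivity and homogeneity hold only up to null sets, so the induction composes
  almost-everywhere equalities. Empty and infinite \<open>I\<close> both reduce to \<open>P\<close>
  sending the zero function to zero almost everywhere.\<close>

lemma bounded_operator_sum:
  assumes P: "bounded_operator M P" and "\<And>i. i \<in> I \<Longrightarrow> f i \<in> L2 M"
  shows "ae_eq M (P (\<lambda>\<omega>. \<Sum>i\<in>I. c i * f i \<omega>)) (\<lambda>\<omega>. \<Sum>i\<in>I. c i * P (f i) \<omega>)"
proof -
  have scale: "ae_eq M (P (\<lambda>\<omega>. c * g \<omega>)) (\<lambda>\<omega>. c * P g \<omega>)" if "g \<in> L2 M" for c g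
    using P that by (simp add: bounded_operator_def)
  have zero: "ae_eq M (P (\<lambda>\<omega>. 0)) (\<lambda>\<omega>. 0)"
    using scale[OF L2_zero, of 0] by simp
  show ?thesis
    using assms(2)
  proof (induction I rule: infinite_finite_induct)
    case (insert i I)
    let ?g = "\<lambda>\<omega>. \<Sum>i\<in>I. c i * f i \<omega>"
    have L2: "(\<lambda>\<omega>. c i * f i \<omega>) \<in> L2 M" "?g \<in> L2 M"
      using insert.prems by (auto intro!: L2_sum L2_scale)
    have 1: "ae_eq M (P (\<lambda>\<omega>. c i * f i \<omega> + ?g \<omega>)) (\<lambda>\<omega>. P (\<lambda>\<omega>. c i * f i \<omega>) \<omega> + P ?g \<omega>)"
      using P L2 by (simp add: bounded_operator_def)
    have 2: "ae_eq M (P (\<lambda>\<omega>. c i * f i \<omega>)) (\<lambda>\<omega>. c i * P (f i) \<omega>)"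
      using insert.prems by (intro scale) simp
    have 3: "ae_eq M (P ?g) (\<lambda>\<omega>. \<Sum>i\<in>I. c i * P (f i) \<omega>)"
      using insert by simp
    have "ae_eq M (P (\<lambda>\<omega>. c i * f i \<omega> + ?g \<omega>)) (\<lambda>\<omega>. c i * P (f i) \<omega> + (\<Sum>i\<in>I. c i * P (f i) \<omega>))"
      using 1 2 3 unfolding ae_eq_def by eventually_elim simp
    then show ?case
      using insert.hyps by simp
  qed (simp_all add: zero)
qed

text \<open>Idempotence inserts a second \<open>P\<close>, and self-adjointness moves it to the
  other argument, which leaves the squared norm of \<open>P f\<close>.\<close>

lemma orthogonal_projection_nonneg:
  assumes P: "orthogonal_projection M P" and f: "f \<in> L2 M"
  shows "ip M (P f) f \<in> \<real>\<^sub>\<ge>\<^sub>0"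
proof -
  have Pf: "P f \<in> L2 M" "P (P f) \<in> L2 M"
    using P f by (auto simp: orthogonal_projection_def bounded_operator_def)
  have "ip M (P f) f = ip M (P (P f)) f"
    using P f Pf by (intro ip_cong_left[symmetric]) (auto simp: orthogonal_projection_def)
  also have "\<dots> = ip M (P f) (P f)"
    using P f Pf by (simp add: orthogonal_projection_def)
  finally show ?thesis
    by (simp add: ip_self_nonneg)
qed

text \<open>The double sum is the expansion of \<open>ip M (P g) g\<close> for \<open>g\<close> the
  combination of the \<open>f i\<close> with coefficients \<open>a i\<close>. The conjugate sits on
  the first coefficient because \<open>ip\<close> is conjugate linear in its first argument.\<close>

lemma orthogonal_projection_sum_nonneg:
  assumes P: "orthogonal_projection M P" and f: "\<And>i. i \<in> I \<Longrightarrow> f i \<in> L2 M"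
  shows "(\<Sum>(i, j)\<in>I \<times> I. cnj (a i) * a j * ip M (P (f i)) (f j)) \<in> \<real>\<^sub>\<ge>\<^sub>0"
proof -
  let ?g = "\<lambda>\<omega>. \<Sum>i\<in>I. a i * f i \<omega>"
  have bo: "bounded_operator M P"
    using P by (simp add: orthogonal_projection_def)
  have Pf: "P h \<in> L2 M" if "h \<in> L2 M" for h
    using bo that by (simp add: bounded_operator_def)
  have g: "?g \<in> L2 M"
    by (intro L2_sum L2_scale f)
  have "ip M (P ?g) ?g = ip M (\<lambda>\<omega>. \<Sum>i\<in>I. a i * P (f i) \<omega>) ?g"
    by (intro ip_cong_left bounded_operator_sum[OF bo] f Pf g L2_sum L2_scale)
  also have "\<dots> = (\<Sum>i\<in>I. \<Sum>j\<in>I. cnj (a i) * a j * ip M (P (f i)) (f j))"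
    by (simp add: ip_sum_left g L2_scale Pf f ip_scale_left ip_sum_right ip_scale_right
        sum_distrib_left mult.assoc)
  also have "\<dots> = (\<Sum>(i, j)\<in>I \<times> I. cnj (a i) * a j * ip M (P (f i)) (f j))"
    by (rule sum.cartesian_product)
  finally show ?thesis
    using orthogonal_projection_nonneg[OF P g] by simp
qed

section \<open>Square index sets and a product bound\<close>

text \<open>Every finite set of pairs lies in a finite square, so an unconditional double sum can be
  computed along squares, where positivity of quadratic forms is available.\<close>

lemma filterlim_Times_finite_subsets:
  "filterlim (\<lambda>F. F \<times> F) (finite_subsets_at_top (A \<times> A)) (finite_subsets_at_top A)"
  unfolding filterlim_iff
proof (intro allI impI)
  fix P assume "eventually P (finite_subsets_at_top (A \<times> A))"
  then obtain X where
    X: "finite X \<and> X \<subseteq> A \<times> A \<and> (\<forall>Y. finite Y \<and> X \<subseteq> Y \<and> Y \<subseteq> A \<times> A \<longrightarrow> P Y)"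
    unfolding eventually_finite_subsets_at_top by (rule exE)
  then have P: "P Y" if "finite Y" "X \<subseteq> Y" "Y \<subseteq> A \<times> A" for Y
    using that by simp
  show "\<forall>\<^sub>F F in finite_subsets_at_top A. P (F \<times> F)"
    unfolding eventually_finite_subsets_at_top
  \<comment> \<open>The union of the two projections is the smallest set whose square contains
    \<open>X\<close>.\<close>
  proof (intro exI[of _ "fst ` X \<union> snd ` X"] conjI allI impI)
    fix Y assume Y: "finite Y \<and> fst ` X \<union> snd ` X \<subseteq> Y \<and> Y \<subseteq> A"
    show "P (Y \<times> Y)"
    proof (rule P)
      show "X \<subseteq> Y \<times> Y"
      proof
        fix z assume "z \<in> X"
        then have "fst z \<in> Y" "snd z \<in> Y"
          using Y by auto
        then show "z \<in> Y \<times> Y"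
          by (simp add: mem_Times_iff)
      qed
    qed (use Y in auto)
  qed (use X in auto)
qed

text \<open>The target is the uniform bound 4. A constant would not survive the induction, whereas
  this increasing majorant absorbs each new factor. It is sharp at \<open>n = 1\<close>, where both
  sides equal 2.\<close>

lemma prod_inverse_square_le:
  "1 \<le> n \<Longrightarrow> (\<Prod>k<n. (1 / (1 + real k))\<^sup>2 + 1) \<le> 4 * real n / (real n + 1)"
proof (induction n rule: dec_induct)
  case (step n)
  define x where "x = real n"
  have x: "0 \<le> x" "0 < (x + 1) * (x + 1)\<^sup>2" "0 < x + 2"
    by (simp_all add: x_def add_nonneg_pos)
  have "(\<Prod>k<Suc n. (1 / (1 + real k))\<^sup>2 + 1) \<le> 4 * x / (x + 1) * ((1 / (1 + x))\<^sup>2 + 1)"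
    unfolding prod.lessThan_Suc x_def using step.IH by (intro mult_right_mono) auto
  also have "(1 / (1 + x))\<^sup>2 + 1 = (1 + (x + 1)\<^sup>2) / (x + 1)\<^sup>2"
    using x(1) by (simp add: power_divide add_divide_distrib add.commute)
  also have "4 * x / (x + 1) * \<dots> = 4 * x * (1 + (x + 1)\<^sup>2) / ((x + 1) * (x + 1)\<^sup>2)"
    by simp
  also have "\<dots> \<le> 4 * (x + 1) / (x + 2)"
  proof -
    \<comment> \<open>With \<open>y = (x + 1)\<^sup>2\<close> one has
      \<open>x * (x + 2) = y - 1\<close>, so the two sides are \<open>4 * (y\<^sup>2 - 1)\<close>
      and \<open>4 * y\<^sup>2\<close>.\<close>
    have "4 * x * (1 + (x + 1)\<^sup>2) * (x + 2) \<le> 4 * (x + 1) * ((x + 1) * (x + 1)\<^sup>2)"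
      by (simp add: power2_eq_square algebra_simps)
    then have "4 * x * (1 + (x + 1)\<^sup>2) \<le> 4 * (x + 1) / (x + 2) * ((x + 1) * (x + 1)\<^sup>2)"
      by (simp only: pos_le_divide_eq[OF x(3)] times_divide_eq_left)
    then show ?thesis
      by (simp only: pos_divide_le_eq[OF x(2)])
  qed
  also have "\<dots> = 4 * real (Suc n) / (real (Suc n) + 1)"
    by (simp add: x_def add.commute)
  finally show ?case .
qed simp

section \<open>Weights and norms of the test function spaces\<close>

lemma lam_ge_1: "1 \<le> lam \<sigma>"
  unfolding lam_def by (rule prod_ge_1) simp

text \<open>Taking the root of the weight turns finite sums of weights into squares of
  \<open>L2_set\<close>, for which the Minkowski and Cauchy-Schwarz inequalities are at
  hand.\<close>

definition S_weight_root :: "(nat \<Rightarrow> real) \<Rightarrow> real \<Rightarrow> cfun \<Rightarrow> nat set \<Rightarrow> real" where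
  "S_weight_root \<theta> p \<xi> \<sigma> = lam \<sigma> powr p * cmod (ip (bernoulli \<theta>) (Z \<theta> \<sigma>) \<xi>)"

lemma S_weight_eq: "S_weight \<theta> p \<xi> \<sigma> = (S_weight_root \<theta> p \<xi> \<sigma>)\<^sup>2"
  using lam_ge_1[of \<sigma>]
  by (simp add: S_weight_def S_weight_root_def power_mult_distrib powr_power mult.commute)

lemma S_weight_nonneg: "0 \<le> S_weight \<theta> p \<xi> \<sigma>"
  by (simp add: S_weight_eq)

lemma S_norm_nonneg: "0 \<le> S_norm \<theta> p \<xi>"
  by (simp add: S_norm_def infsum_nonneg S_weight_nonneg)

lemma L2_set_le_S_norm:
  assumes "\<xi> \<in> S_level \<theta> p" "finite F" "F \<subseteq> {\<sigma>. finite \<sigma>}"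
  shows "L2_set (S_weight_root \<theta> p \<xi>) F \<le> S_norm \<theta> p \<xi>"
  using finite_sum_le_infsum[of "S_weight \<theta> p \<xi>" "{\<sigma>. finite \<sigma>}" F] assms
  by (simp add: L2_set_def S_norm_def S_level_def S_weight_nonneg flip: S_weight_eq)

text \<open>Partial sums of nonnegative terms that are bounded by the square of \<open>K\<close>
  give summability and the norm bound at once. Norm estimates thereby reduce to finite index
  sets.\<close>

lemma S_level_bounded:
  assumes "\<xi> \<in> L2 (bernoulli \<theta>)" "0 \<le> K"
    and "\<And>F. finite F \<Longrightarrow> F \<subseteq> {\<sigma>. finite \<sigma>} \<Longrightarrow> L2_set (S_weight_root \<theta> p \<xi>) F \<le> K"
  shows "\<xi> \<in> S_level \<theta> p" and "S_norm \<theta> p \<xi> \<le> K"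
proof -
  have le: "sum (S_weight \<theta> p \<xi>) F \<le> K\<^sup>2" if "finite F" "F \<subseteq> {\<sigma>. finite \<sigma>}" for F
    using assms(3)[OF that] by (simp add: L2_set_def S_weight_eq sqrt_le_D)
  have s: "S_weight \<theta> p \<xi> summable_on {\<sigma>. finite \<sigma>}"
    by (rule nonneg_bdd_above_summable_on) (auto intro!: bdd_aboveI2 le S_weight_nonneg)
  then show "\<xi> \<in> S_level \<theta> p"
    using assms(1) by (simp add: S_level_def)
  show "S_norm \<theta> p \<xi> \<le> K"
    unfolding S_norm_def using assms(2) infsum_le_finite_sums[OF s le]
    by (intro real_le_lsqrt) (auto intro!: infsum_nonneg S_weight_nonneg)
qed

text \<open>Since \<open>lam\<close> is at least 1, every term grows with the exponent.\<close>

lemma S_norm_mono: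
  assumes "\<xi> \<in> S_space \<theta>" "0 \<le> p" "p \<le> q"
  shows "S_norm \<theta> p \<xi> \<le> S_norm \<theta> q \<xi>"
proof (rule S_level_bounded)
  fix F :: "nat set set" assume F: "finite F" "F \<subseteq> {\<sigma>. finite \<sigma>}"
  have "L2_set (S_weight_root \<theta> p \<xi>) F \<le> L2_set (S_weight_root \<theta> q \<xi>) F"
    unfolding S_weight_root_def using lam_ge_1 assms
    by (intro L2_set_mono mult_right_mono powr_mono) auto
  also have "\<dots> \<le> S_norm \<theta> q \<xi>"
    using assms by (intro L2_set_le_S_norm F) (auto simp: S_space_def)
  finally show "L2_set (S_weight_root \<theta> p \<xi>) F \<le> S_norm \<theta> q \<xi>" .
qed (use assms in \<open>auto simp: S_space_def S_level_def S_norm_nonneg\<close>)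

lemma S_weight_scale:
  "S_weight \<theta> p (\<lambda>\<omega>. c * \<xi> \<omega>) = (\<lambda>\<sigma>. (cmod c)\<^sup>2 * S_weight \<theta> p \<xi> \<sigma>)"
  by (auto simp: S_weight_def ip_scale_right norm_mult power_mult_distrib)

lemma S_norm_scale: "S_norm \<theta> p (\<lambda>\<omega>. c * \<xi> \<omega>) = cmod c * S_norm \<theta> p \<xi>"
  by (simp add: S_norm_def S_weight_scale infsum_cmult_right' real_sqrt_mult)

lemma S_space_L2: "\<xi> \<in> S_space \<theta> \<Longrightarrow> \<xi> \<in> L2 (bernoulli \<theta>)"
  by (auto simp: S_space_def S_level_def)

lemma S_space_scale: "\<xi> \<in> S_space \<theta> \<Longrightarrow> (\<lambda>\<omega>. c * \<xi> \<omega>) \<in> S_space \<theta>"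
  by (auto simp: S_space_def S_level_def S_weight_scale L2_scale intro: summable_on_cmult_right)

section \<open>Orthonormality of the functions \<open>Z\<close>\<close>

locale bernoulli_space =
  fixes \<theta> :: "nat \<Rightarrow> real"
  assumes \<theta>: "0 < \<theta> n \<and> \<theta> n < 1"
begin

sublocale prob_space "bernoulli \<theta>"
  using \<theta> by (rule prob_space_bernoulli)

text \<open>The normalised variable \<open>Z\<^sub>i\<close> as a function of the value
  \<open>x\<close> of its coordinate. This separation exhibits \<open>Z\<close> as a product of
  functions of single coordinates, as independence requires.\<close>

definition std :: "nat \<Rightarrow> real \<Rightarrow> complex" where
  "std i x = complex_of_real ((x + 1 - 2 * \<theta> i) / (2 * sqrt (\<theta> i * (1 - \<theta> i))))"

lemma Z_eq: "Z \<theta> \<sigma> \<omega> = (\<Prod>i\<in>\<sigma>. std i (\<omega> i))"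
  by (simp add: Z_def std_def)

lemma cnj_Z: "cnj (Z \<theta> \<sigma> \<omega>) = Z \<theta> \<sigma> \<omega>"
  by (simp add: Z_def)

lemma integral_coordinate:
  fixes g :: "real \<Rightarrow> complex"
  shows "integrable (bernoulli \<theta>) (\<lambda>\<omega>. g (\<omega> i))"
    and "(LINT \<omega>|bernoulli \<theta>. g (\<omega> i)) = (1 - \<theta> i) * g (-1) + \<theta> i * g 1"
proof -
  note m = measurable_coordinate[of "bernoulli \<theta>" \<theta> i, OF refl]
  have d: "distr (bernoulli \<theta>) (count_space {-1, 1}) (\<lambda>\<omega>. \<omega> i) = coin (\<theta> i)"
    using \<theta> by (rule distr_coordinate)
  have "integrable (coin (\<theta> i)) g"
    using \<theta>[of i] unfolding coin_def by (intro integrable_point_measure_finite) auto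
  then show "integrable (bernoulli \<theta>) (\<lambda>\<omega>. g (\<omega> i))"
    using m by (simp add: integrable_distr_eq flip: d)
  have "(LINT \<omega>|bernoulli \<theta>. g (\<omega> i)) = (LINT x|coin (\<theta> i). g x)"
    using m by (simp add: integral_distr flip: d)
  also have "\<dots> = (1 - \<theta> i) * g (-1) + \<theta> i * g 1"
    using \<theta>[of i] unfolding coin_def
    by (subst lebesgue_integral_point_measure_finite) (auto simp: scaleR_conv_of_real)
  finally show "(LINT \<omega>|bernoulli \<theta>. g (\<omega> i)) = (1 - \<theta> i) * g (-1) + \<theta> i * g 1" .
qed

text \<open>Functions of distinct coordinates are independent, so the integral factorises into
  expectations under the two-point laws.\<close>

lemma integral_prod_coordinate:
  fixes g :: "nat \<Rightarrow> real \<Rightarrow> complex"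
  assumes "finite I"
  shows "integrable (bernoulli \<theta>) (\<lambda>\<omega>. \<Prod>i\<in>I. g i (\<omega> i))"
    and "(LINT \<omega>|bernoulli \<theta>. (\<Prod>i\<in>I. g i (\<omega> i))) = (\<Prod>i\<in>I. (1 - \<theta> i) * g i (-1) + \<theta> i * g i 1)"
proof -
  have "indep_vars (\<lambda>n. count_space {-1, 1}) (\<lambda>n \<omega>. \<omega> n) UNIV"
    using \<theta> by (rule bernoulli_properties)
  then have "indep_vars (\<lambda>n. count_space {-1, 1}) (\<lambda>n \<omega>. \<omega> n) I"
    by (rule indep_vars_subset) simp
  then have *: "indep_vars (\<lambda>i. borel) (\<lambda>i \<omega>. g i (\<omega> i)) I"
    by (rule indep_vars_compose2) simp
  show "integrable (bernoulli \<theta>) (\<lambda>\<omega>. \<Prod>i\<in>I. g i (\<omega> i))"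
    by (intro indep_vars_integrable assms * integral_coordinate)
  show "(LINT \<omega>|bernoulli \<theta>. (\<Prod>i\<in>I. g i (\<omega> i))) =
      (\<Prod>i\<in>I. (1 - \<theta> i) * g i (-1) + \<theta> i * g i 1)"
    using indep_vars_lebesgue_integral[OF assms * integral_coordinate(1)]
    by (simp add: integral_coordinate(2))
qed

text \<open>Mean 0 and variance 1 of the normalised coordinate; \<open>s\<close> below is the
  standard deviation of a Bernoulli variable with success probability
  \<open>\<theta> i\<close>.\<close>

lemma std_moments:
  "(1 - \<theta> i) * std i (-1) + \<theta> i * std i 1 = 0"
  "(1 - \<theta> i) * (std i (-1))\<^sup>2 + \<theta> i * (std i 1)\<^sup>2 = 1"
proof -
  define s where "s = sqrt (\<theta> i * (1 - \<theta> i))"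
  have s: "s \<noteq> 0" "s\<^sup>2 = \<theta> i * (1 - \<theta> i)"
    using \<theta>[of i] by (auto simp: s_def)
  have e: "std i (-1) = complex_of_real (- \<theta> i / s)" "std i 1 = complex_of_real ((1 - \<theta> i) / s)"
    by (simp_all add: std_def s_def[symmetric] divide_simps flip: of_real_mult of_real_diff)
  have "(1 - \<theta> i) * (- \<theta> i / s) + \<theta> i * ((1 - \<theta> i) / s) = 0"
    by (simp add: field_simps)
  then show "(1 - \<theta> i) * std i (-1) + \<theta> i * std i 1 = 0"
    unfolding e by (simp only: of_real_eq_0_iff flip: of_real_mult of_real_add)
  have "(1 - \<theta> i) * (- \<theta> i / s)\<^sup>2 + \<theta> i * ((1 - \<theta> i) / s)\<^sup>2 = (\<theta> i * (1 - \<theta> i)) / s\<^sup>2"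
    by (simp add: power_divide add_divide_distrib[symmetric] power2_eq_square[of "\<theta> i"]
        power2_eq_square[of "1 - \<theta> i"]) (simp add: algebra_simps)
  also have "\<dots> = 1"
    using s(1) unfolding s(2)[symmetric] by simp
  finally show "(1 - \<theta> i) * (std i (-1))\<^sup>2 + \<theta> i * (std i 1)\<^sup>2 = 1"
    unfolding e by (simp only: of_real_eq_1_iff flip: of_real_mult of_real_add of_real_power)
qed

text \<open>The exponent is 1 on the symmetric difference and 2 on the intersection. In this form
  the product has one factor per coordinate, so its integral factorises.\<close>

lemma Z_mult:
  assumes "finite \<sigma>" "finite \<tau>"
  shows "Z \<theta> \<sigma> \<omega> * Z \<theta> \<tau> \<omega> =
    (\<Prod>i\<in>\<sigma> \<union> \<tau>. std i (\<omega> i) ^ (of_bool (i \<in> \<sigma>) + of_bool (i \<in> \<tau>)))"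
proof -
  have *: "Z \<theta> \<sigma>' \<omega> = (\<Prod>i\<in>\<sigma> \<union> \<tau>. std i (\<omega> i) ^ of_bool (i \<in> \<sigma>'))"
    if "\<sigma>' \<subseteq> \<sigma> \<union> \<tau>" for \<sigma>'
    unfolding Z_eq using assms that by (intro prod.mono_neutral_cong_left) auto
  show ?thesis
    unfolding power_add prod.distrib by (intro arg_cong2[where f = "(*)"] *) auto
qed

lemma Z_L2:
  assumes "finite \<sigma>"
  shows "Z \<theta> \<sigma> \<in> L2 (bernoulli \<theta>)"
proof -
  have "complex_of_real ((cmod (Z \<theta> \<sigma> \<omega>))\<^sup>2) = Z \<theta> \<sigma> \<omega> * Z \<theta> \<sigma> \<omega>" for \<omega>
    by (simp only: complex_norm_square cnj_Z)
  moreover have "integrable (bernoulli \<theta>) (\<lambda>\<omega>. Z \<theta> \<sigma> \<omega> * Z \<theta> \<sigma> \<omega>)"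
    unfolding Z_mult[OF assms assms] using assms by (intro integral_prod_coordinate) simp
  ultimately have "integrable (bernoulli \<theta>) (\<lambda>\<omega>. complex_of_real ((cmod (Z \<theta> \<sigma> \<omega>))\<^sup>2))"
    by simp
  then have "integrable (bernoulli \<theta>) (\<lambda>\<omega>. (cmod (Z \<theta> \<sigma> \<omega>))\<^sup>2)"
    by (simp only: complex_of_real_integrable_eq)
  moreover have "integrable (bernoulli \<theta>) (Z \<theta> \<sigma>)"
    using integral_prod_coordinate(1)[OF assms, of std] by (simp add: Z_eq[abs_def])
  ultimately show ?thesis
    by (auto simp: L2_def)
qed

text \<open>A coordinate in the intersection contributes the variance 1, one in the symmetric
  difference the mean 0; distinct index sets have at least one of the latter kind.\<close>

lemma Z_orthonormal:
  assumes "finite \<sigma>" "finite \<tau>"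
  shows "ip (bernoulli \<theta>) (Z \<theta> \<sigma>) (Z \<theta> \<tau>) = of_bool (\<sigma> = \<tau>)"
proof -
  let ?n = "\<lambda>i. of_bool (i \<in> \<sigma>) + of_bool (i \<in> \<tau>) :: nat"
  have "ip (bernoulli \<theta>) (Z \<theta> \<sigma>) (Z \<theta> \<tau>) =
      (LINT \<omega>|bernoulli \<theta>. (\<Prod>i\<in>\<sigma> \<union> \<tau>. std i (\<omega> i) ^ ?n i))"
    by (simp add: ip_def cnj_Z Z_mult[OF assms])
  also have "\<dots> = (\<Prod>i\<in>\<sigma> \<union> \<tau>. (1 - \<theta> i) * std i (-1) ^ ?n i + \<theta> i * std i 1 ^ ?n i)"
    using assms by (subst integral_prod_coordinate) auto
  \<comment> \<open>On the union the exponent is never 0, so the two moment identities cover every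
    factor.\<close>
  also have "\<dots> = (\<Prod>i\<in>\<sigma> \<union> \<tau>. of_bool (i \<in> \<sigma> \<inter> \<tau>))"
    using std_moments by (intro prod.cong) (auto simp: numeral_2_eq_2[symmetric])
  also have "\<dots> = of_bool (\<sigma> = \<tau>)"
    using assms by (cases "\<sigma> = \<tau>") (auto intro!: prod_zero)
  finally show ?thesis .
qed

section \<open>Linear structure of the test space\<close>

abbreviation FS :: "nat set set" where
  "FS \<equiv> {\<sigma>. finite \<sigma>}"

abbreviation coeff :: "cfun \<Rightarrow> nat set \<Rightarrow> complex" where
  "coeff \<xi> \<sigma> \<equiv> ip (bernoulli \<theta>) (Z \<theta> \<sigma>) \<xi>"

lemma coeff_add:
  assumes "finite \<sigma>" "\<xi> \<in> L2 (bernoulli \<theta>)" "\<eta> \<in> L2 (bernoulli \<theta>)"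
  shows "coeff (\<lambda>\<omega>. \<xi> \<omega> + \<eta> \<omega>) \<sigma> = coeff \<xi> \<sigma> + coeff \<eta> \<sigma>"
  using assms by (intro ip_add_right Z_L2)

lemma coeff_cnj: "coeff (\<lambda>\<omega>. cnj (\<xi> \<omega>)) \<sigma> = cnj (coeff \<xi> \<sigma>)"
  by (simp add: ip_def cnj_Z flip: Bochner_Integration.integral_cnj)

text \<open>Minkowski's inequality on each finite index set gives a bound independent of that
  set.\<close>

lemma S_level_add:
  assumes "\<xi> \<in> S_level \<theta> p" "\<eta> \<in> S_level \<theta> p"
  shows "(\<lambda>\<omega>. \<xi> \<omega> + \<eta> \<omega>) \<in> S_level \<theta> p"
    and "S_norm \<theta> p (\<lambda>\<omega>. \<xi> \<omega> + \<eta> \<omega>) \<le> S_norm \<theta> p \<xi> + S_norm \<theta> p \<eta>"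
proof -
  have L2: "\<xi> \<in> L2 (bernoulli \<theta>)" "\<eta> \<in> L2 (bernoulli \<theta>)"
    using assms by (auto simp: S_level_def)
  have *: "L2_set (S_weight_root \<theta> p (\<lambda>\<omega>. \<xi> \<omega> + \<eta> \<omega>)) F \<le> S_norm \<theta> p \<xi> + S_norm \<theta> p \<eta>"
    if F: "finite F" "F \<subseteq> FS" for F
  proof -
    have "L2_set (S_weight_root \<theta> p (\<lambda>\<omega>. \<xi> \<omega> + \<eta> \<omega>)) F
        \<le> L2_set (\<lambda>\<sigma>. S_weight_root \<theta> p \<xi> \<sigma> + S_weight_root \<theta> p \<eta> \<sigma>) F"
    proof (rule L2_set_mono)
      fix \<sigma> assume "\<sigma> \<in> F"
      then have "finite \<sigma>"
        using F by auto
      then show "S_weight_root \<theta> p (\<lambda>\<omega>. \<xi> \<omega> + \<eta> \<omega>) \<sigma>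
          \<le> S_weight_root \<theta> p \<xi> \<sigma> + S_weight_root \<theta> p \<eta> \<sigma>"
        by (simp add: S_weight_root_def coeff_add L2 norm_triangle_ineq mult_left_mono
            flip: distrib_left)
    qed (simp add: S_weight_root_def)
    also have "\<dots> \<le> L2_set (S_weight_root \<theta> p \<xi>) F + L2_set (S_weight_root \<theta> p \<eta>) F"
      by (rule L2_set_triangle_ineq)
    also have "\<dots> \<le> S_norm \<theta> p \<xi> + S_norm \<theta> p \<eta>"
      using assms F by (intro add_mono L2_set_le_S_norm)
    finally show ?thesis .
  qed
  show "(\<lambda>\<omega>. \<xi> \<omega> + \<eta> \<omega>) \<in> S_level \<theta> p"
    by (rule S_level_bounded[OF _ _ *]) (simp_all add: L2_add L2 S_norm_nonneg)
  show "S_norm \<theta> p (\<lambda>\<omega>. \<xi> \<omega> + \<eta> \<omega>) \<le> S_norm \<theta> p \<xi> + S_norm \<theta> p \<eta>"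
    by (rule S_level_bounded[OF _ _ *]) (simp_all add: L2_add L2 S_norm_nonneg)
qed

lemma S_space_add:
  "\<lbrakk>\<xi> \<in> S_space \<theta>; \<eta> \<in> S_space \<theta>\<rbrakk> \<Longrightarrow> (\<lambda>\<omega>. \<xi> \<omega> + \<eta> \<omega>) \<in> S_space \<theta>"
  by (auto simp: S_space_def intro: S_level_add)

lemma S_space_diff:
  assumes "\<xi> \<in> S_space \<theta>" "\<eta> \<in> S_space \<theta>"
  shows "(\<lambda>\<omega>. \<xi> \<omega> - \<eta> \<omega>) \<in> S_space \<theta>"
  using S_space_add[OF assms(1) S_space_scale[OF assms(2), of "-1"]] by simp

lemma S_space_zero: "(\<lambda>\<omega>. 0) \<in> S_space \<theta>"
  by (auto simp: S_space_def S_level_def L2_zero S_weight_def[abs_def] ip_def)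

lemma S_norm_zero: "S_norm \<theta> p (\<lambda>\<omega>. 0) = 0"
  by (simp add: S_norm_def S_weight_def ip_def)

lemma S_space_sum: "(\<And>i. i \<in> I \<Longrightarrow> f i \<in> S_space \<theta>) \<Longrightarrow> (\<lambda>\<omega>. \<Sum>i\<in>I. f i \<omega>) \<in> S_space \<theta>"
  by (induction I rule: infinite_finite_induct) (auto intro: S_space_zero S_space_add)

lemma S_space_cnj: "\<xi> \<in> S_space \<theta> \<Longrightarrow> (\<lambda>\<omega>. cnj (\<xi> \<omega>)) \<in> S_space \<theta>"
  by (auto simp: S_space_def S_level_def L2_cnj S_weight_def[abs_def] coeff_cnj)

text \<open>By orthonormality only the weight at \<open>\<tau>\<close> can be nonzero.\<close>

lemma Z_S_space:
  assumes "finite \<tau>"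
  shows "Z \<theta> \<tau> \<in> S_space \<theta>"
proof -
  have "S_weight \<theta> p (Z \<theta> \<tau>) summable_on FS \<longleftrightarrow> S_weight \<theta> p (Z \<theta> \<tau>) summable_on {\<tau>}" for p
    using assms by (intro summable_on_cong_neutral) (auto simp: S_weight_def Z_orthonormal)
  then show ?thesis
    using assms by (simp add: S_space_def S_level_def Z_L2)
qed

lemma S_norm_triangle:
  assumes "\<xi> \<in> S_space \<theta>" "\<eta> \<in> S_space \<theta>" "\<zeta> \<in> S_space \<theta>" "0 \<le> p"
  shows "S_norm \<theta> p (\<lambda>\<omega>. \<xi> \<omega> - \<zeta> \<omega>)
    \<le> S_norm \<theta> p (\<lambda>\<omega>. \<xi> \<omega> - \<eta> \<omega>) + S_norm \<theta> p (\<lambda>\<omega>. \<eta> \<omega> - \<zeta> \<omega>)"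
  using S_level_add(2)[of "\<lambda>\<omega>. \<xi> \<omega> - \<eta> \<omega>" p "\<lambda>\<omega>. \<eta> \<omega> - \<zeta> \<omega>"]
    S_space_diff[OF assms(1,2)] S_space_diff[OF assms(2,3)] assms(4)
  by (simp add: S_space_def)

section \<open>Convergence of the basis expansion in every norm\<close>

definition partial_sum :: "cfun \<Rightarrow> nat set set \<Rightarrow> cfun" where
  "partial_sum \<xi> F = (\<lambda>\<omega>. \<Sum>\<sigma>\<in>F. coeff \<xi> \<sigma> * Z \<theta> \<sigma> \<omega>)"

lemma partial_sum_S_space: "F \<subseteq> FS \<Longrightarrow> partial_sum \<xi> F \<in> S_space \<theta>"
  unfolding partial_sum_def by (intro S_space_sum S_space_scale Z_S_space) auto

lemma coeff_partial_sum:
  assumes "finite F" "F \<subseteq> FS" "finite \<tau>"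
  shows "coeff (partial_sum \<xi> F) \<tau> = (if \<tau> \<in> F then coeff \<xi> \<tau> else 0)"
proof -
  have "coeff (partial_sum \<xi> F) \<tau> = (\<Sum>\<sigma>\<in>F. coeff \<xi> \<sigma> * coeff (Z \<theta> \<sigma>) \<tau>)"
    unfolding partial_sum_def using assms
    by (subst ip_sum_right) (auto intro!: Z_L2 L2_scale simp: ip_scale_right)
  also have "\<dots> = (\<Sum>\<sigma>\<in>F. if \<sigma> = \<tau> then coeff \<xi> \<tau> else 0)"
    using assms by (intro sum.cong) (auto simp: Z_orthonormal)
  also have "\<dots> = (if \<tau> \<in> F then coeff \<xi> \<tau> else 0)"
    using assms by simp
  finally show ?thesis .
qed

text \<open>The squared norm of the remainder is the tail of a convergent series of weights.\<close>

lemma partial_sum_tendsto: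
  assumes \<xi>: "\<xi> \<in> S_space \<theta>" and "0 \<le> p"
  shows "((\<lambda>F. S_norm \<theta> p (\<lambda>\<omega>. \<xi> \<omega> - partial_sum \<xi> F \<omega>)) \<longlongrightarrow> 0) (finite_subsets_at_top FS)"
proof -
  let ?w = "S_weight \<theta> p \<xi>"
  have s: "?w summable_on FS"
    using assms by (auto simp: S_space_def S_level_def)
  have eq: "S_norm \<theta> p (\<lambda>\<omega>. \<xi> \<omega> - partial_sum \<xi> F \<omega>) = sqrt (infsum ?w FS - sum ?w F)"
    if F: "finite F" "F \<subseteq> FS" for F
  proof -
    \<comment> \<open>Subtraction is treated as adding -1 times the partial sum; coefficients with
      index in \<open>F\<close> cancel and the others are unchanged.\<close>
    have "coeff (\<lambda>\<omega>. \<xi> \<omega> - partial_sum \<xi> F \<omega>) \<sigma> = (if \<sigma> \<in> F then 0 else coeff \<xi> \<sigma>)"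
      if "finite \<sigma>" for \<sigma>
      using coeff_add[OF that S_space_L2[OF \<xi>] L2_scale[OF S_space_L2[OF partial_sum_S_space[OF F(2)]]],
          of "-1"]
      unfolding ip_scale_right coeff_partial_sum[OF F that] by auto
    then have "infsum (S_weight \<theta> p (\<lambda>\<omega>. \<xi> \<omega> - partial_sum \<xi> F \<omega>)) FS = infsum ?w (FS - F)"
      by (intro infsum_cong_neutral) (auto simp: S_weight_def)
    also have "\<dots> = infsum ?w FS - sum ?w F"
      using F s by (subst infsum_Diff) auto
    finally show ?thesis
      by (simp add: S_norm_def)
  qed
  have "((\<lambda>F. sqrt (infsum ?w FS - sum ?w F)) \<longlongrightarrow> sqrt (infsum ?w FS - infsum ?w FS))
      (finite_subsets_at_top FS)"
    by (intro tendsto_intros infsum_tendsto s)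
  then have "((\<lambda>F. sqrt (infsum ?w FS - sum ?w F)) \<longlongrightarrow> 0) (finite_subsets_at_top FS)"
    by simp
  then show ?thesis
    by (rule Lim_transform_eventually) (rule eventually_finite_subsets_at_top_weakI, simp add: eq)
qed

section \<open>Neighbourhoods in the topology of the test space\<close>

definition S_ball :: "real \<Rightarrow> cfun \<Rightarrow> real \<Rightarrow> cfun set" where
  "S_ball p \<xi> r = {\<eta> \<in> S_space \<theta>. S_norm \<theta> p (\<lambda>\<omega>. \<eta> \<omega> - \<xi> \<omega>) < r}"

lemma centre_in_S_ball: "\<xi> \<in> S_space \<theta> \<Longrightarrow> 0 < r \<Longrightarrow> \<xi> \<in> S_ball p \<xi> r"
  by (simp add: S_ball_def S_norm_zero)

lemma S_ball_mono:
  assumes "\<xi> \<in> S_space \<theta>" "0 \<le> p" "p \<le> q" "r \<le> s"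
  shows "S_ball q \<xi> r \<subseteq> S_ball p \<xi> s"
proof
  fix \<eta> assume "\<eta> \<in> S_ball q \<xi> r"
  then show "\<eta> \<in> S_ball p \<xi> s"
    using S_norm_mono[OF S_space_diff[of \<eta> \<xi>], of p q] assms by (auto simp: S_ball_def)
qed

text \<open>The balls are given only as a subbasis. They form a neighbourhood base because the norms
  increase with the exponent, so a finite intersection of balls about a point contains one ball
  about it.\<close>

lemma openin_S_topology:
  "openin (S_topology \<theta>) U \<longleftrightarrow>
    U \<subseteq> S_space \<theta> \<and> (\<forall>\<xi>\<in>U. \<exists>p\<ge>0. \<exists>r>0. S_ball p \<xi> r \<subseteq> U)"
proof -
  define \<B> where "\<B> = {S_ball p \<xi> r | \<xi> p r. \<xi> \<in> S_space \<theta> \<and> 0 \<le> p \<and> 0 < r}"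
  have top: "S_topology \<theta> = topology_generated_by \<B>"
    unfolding S_topology_def \<B>_def S_ball_def ..
  show ?thesis
  proof
    assume "openin (S_topology \<theta>) U"
    then have "generate_topology_on \<B> U"
      unfolding top by (rule openin_topology_generated_by)
    then show "U \<subseteq> S_space \<theta> \<and> (\<forall>\<xi>\<in>U. \<exists>p\<ge>0. \<exists>r>0. S_ball p \<xi> r \<subseteq> U)"
    proof induction
      case Empty
      show ?case by simp
    next
      case (Int a b)
      have "\<exists>p\<ge>0. \<exists>r>0. S_ball p \<xi> r \<subseteq> a \<inter> b" if \<xi>: "\<xi> \<in> a \<inter> b" for \<xi>
      proof -
        obtain p r where pr: "p \<ge> 0" "r > 0" "S_ball p \<xi> r \<subseteq> a"
          using Int.IH(1) \<xi> by blast
        obtain q s where qs: "q \<ge> 0" "s > 0" "S_ball q \<xi> s \<subseteq> b"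
          using Int.IH(2) \<xi> by blast
        \<comment> \<open>A larger exponent and a smaller radius both shrink a ball with fixed
          centre.\<close>
        have "S_ball (max p q) \<xi> (min r s) \<subseteq> S_ball p \<xi> r \<inter> S_ball q \<xi> s"
          using pr qs \<xi> Int.IH by (intro Int_greatest S_ball_mono) auto
        with pr qs have "0 \<le> max p q" "0 < min r s" "S_ball (max p q) \<xi> (min r s) \<subseteq> a \<inter> b"
          by auto
        then show ?thesis
          by blast
      qed
      then show ?case
        using Int.IH by blast
    next
      case (UN K)
      have "\<exists>p\<ge>0. \<exists>r>0. S_ball p \<xi> r \<subseteq> \<Union>K" if \<xi>: "\<xi> \<in> \<Union>K" for \<xi>
      proof -
        obtain k where k: "k \<in> K" "\<xi> \<in> k"
          using \<xi> by blast
        then obtain p r where "p \<ge> 0" "r > 0" "S_ball p \<xi> r \<subseteq> k"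
          using UN.IH by blast
        with k show ?thesis
          by blast
      qed
      then show ?case
        using UN.IH by blast
    next
      case (Basis U)
      then obtain \<xi> p r where U: "U = S_ball p \<xi> r" "\<xi> \<in> S_space \<theta>" "0 \<le> p" "0 < r"
        by (auto simp: \<B>_def)
      \<comment> \<open>What remains of the radius after moving the centre to \<open>\<eta>\<close>;
        the triangle inequality keeps the new ball inside \<open>U\<close>.\<close>
      have "0 < r - S_norm \<theta> p (\<lambda>\<omega>. \<eta> \<omega> - \<xi> \<omega>)" if "\<eta> \<in> U" for \<eta>
        using that U(1) by (simp add: S_ball_def)
      moreover have "S_ball p \<eta> (r - S_norm \<theta> p (\<lambda>\<omega>. \<eta> \<omega> - \<xi> \<omega>)) \<subseteq> U" if "\<eta> \<in> U" for \<eta>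
      proof
        fix \<zeta> assume "\<zeta> \<in> S_ball p \<eta> (r - S_norm \<theta> p (\<lambda>\<omega>. \<eta> \<omega> - \<xi> \<omega>))"
        then show "\<zeta> \<in> U"
          using S_norm_triangle[of \<zeta> \<eta> \<xi> p] that U by (auto simp: S_ball_def)
      qed
      moreover have "U \<subseteq> S_space \<theta>"
        unfolding U(1) S_ball_def by blast
      ultimately show ?case
        using U(3) by blast
    qed
  next
    assume U: "U \<subseteq> S_space \<theta> \<and> (\<forall>\<xi>\<in>U. \<exists>p\<ge>0. \<exists>r>0. S_ball p \<xi> r \<subseteq> U)"
    have "\<exists>V. openin (S_topology \<theta>) V \<and> \<xi> \<in> V \<and> V \<subseteq> U" if "\<xi> \<in> U" for \<xi>
    proof -
      obtain p r where pr: "p \<ge> 0" "r > 0" "S_ball p \<xi> r \<subseteq> U"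
        using U \<open>\<xi> \<in> U\<close> by blast
      have "openin (S_topology \<theta>) (S_ball p \<xi> r)"
        unfolding top
      proof (rule topology_generated_by_Basis)
        have "\<xi> \<in> S_space \<theta>"
          using U that by blast
        with pr show "S_ball p \<xi> r \<in> \<B>"
          unfolding \<B>_def by blast
      qed
      then show ?thesis
        using pr centre_in_S_ball[of \<xi> r p] that U by blast
    qed
    then show "openin (S_topology \<theta>) U"
      using openin_subopen[of "S_topology \<theta>" U] by blast
  qed
qed

lemma topspace_S_topology: "topspace (S_topology \<theta>) = S_space \<theta>"
proof
  have "openin (S_topology \<theta>) (topspace (S_topology \<theta>))"
    by (rule openin_topspace)
  then show "topspace (S_topology \<theta>) \<subseteq> S_space \<theta>"
    unfolding openin_S_topology by (rule conjunct1)
  have "S_ball 0 \<xi> 1 \<subseteq> S_space \<theta>" for \<xi>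
    by (auto simp: S_ball_def)
  then have "openin (S_topology \<theta>) (S_space \<theta>)"
    unfolding openin_S_topology using zero_less_one by blast
  then show "S_space \<theta> \<subseteq> topspace (S_topology \<theta>)"
    by (rule openin_subset)
qed

section \<open>Continuous linear functionals and their expansion\<close>

text \<open>Linearity is kept apart from extensionality, so that it also applies to maps such as
  \<open>\<lambda>\<xi>. T \<xi> \<eta>\<close> that are not elements of
  \<open>S_dual\<close>.\<close>

definition S_linear :: "(cfun \<Rightarrow> complex) \<Rightarrow> bool" where
  "S_linear L \<longleftrightarrow>
     (\<forall>\<xi>\<in>S_space \<theta>. \<forall>\<eta>\<in>S_space \<theta>. L (\<lambda>\<omega>. \<xi> \<omega> + \<eta> \<omega>) = L \<xi> + L \<eta>) \<and>
     (\<forall>\<xi>\<in>S_space \<theta>. \<forall>c. L (\<lambda>\<omega>. c * \<xi> \<omega>) = c * L \<xi>)"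

lemma S_linear_add:
  "\<lbrakk>S_linear L; \<xi> \<in> S_space \<theta>; \<eta> \<in> S_space \<theta>\<rbrakk> \<Longrightarrow> L (\<lambda>\<omega>. \<xi> \<omega> + \<eta> \<omega>) = L \<xi> + L \<eta>"
  by (simp add: S_linear_def)

lemma S_linear_scale:
  "\<lbrakk>S_linear L; \<xi> \<in> S_space \<theta>\<rbrakk> \<Longrightarrow> L (\<lambda>\<omega>. c * \<xi> \<omega>) = c * L \<xi>"
  by (simp add: S_linear_def)

lemma S_linear_zero: "S_linear L \<Longrightarrow> L (\<lambda>\<omega>. 0) = 0"
  using S_linear_scale[of L "\<lambda>\<omega>. 0" 0] S_space_zero by simp

lemma S_linear_diff:
  assumes "S_linear L" "\<xi> \<in> S_space \<theta>" "\<eta> \<in> S_space \<theta>"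
  shows "L (\<lambda>\<omega>. \<xi> \<omega> - \<eta> \<omega>) = L \<xi> - L \<eta>"
proof -
  have "L (\<lambda>\<omega>. \<xi> \<omega> + (- 1) * \<eta> \<omega>) = L \<xi> + L (\<lambda>\<omega>. (- 1) * \<eta> \<omega>)"
    by (intro S_linear_add S_space_scale assms)
  also have "L (\<lambda>\<omega>. (- 1) * \<eta> \<omega>) = (- 1) * L \<eta>"
    by (intro S_linear_scale assms)
  finally show ?thesis
    by simp
qed

lemma S_linear_sum:
  assumes L: "S_linear L" and "\<And>i. i \<in> I \<Longrightarrow> f i \<in> S_space \<theta>"
  shows "L (\<lambda>\<omega>. \<Sum>i\<in>I. c i * f i \<omega>) = (\<Sum>i\<in>I. c i * L (f i))"
  using assms(2)
proof (induction I rule: infinite_finite_induct)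
  case (insert i I)
  have "(\<lambda>\<omega>. \<Sum>i\<in>I. c i * f i \<omega>) \<in> S_space \<theta>"
    using insert.prems by (intro S_space_sum S_space_scale) auto
  moreover have "(\<lambda>\<omega>. c i * f i \<omega>) \<in> S_space \<theta>"
    using insert.prems by (intro S_space_scale) auto
  ultimately have "L (\<lambda>\<omega>. c i * f i \<omega> + (\<Sum>i\<in>I. c i * f i \<omega>)) =
      L (\<lambda>\<omega>. c i * f i \<omega>) + L (\<lambda>\<omega>. \<Sum>i\<in>I. c i * f i \<omega>)"
    by (intro S_linear_add L)
  also have "L (\<lambda>\<omega>. c i * f i \<omega>) = c i * L (f i)"
    using insert.prems by (intro S_linear_scale L) auto
  finally show ?case
    using insert by simp
qed (simp_all add: S_linear_zero[OF L])

text \<open>Quantitative form of continuity: a single norm dominates the functional.\<close>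

definition S_bound :: "(cfun \<Rightarrow> complex) \<Rightarrow> real \<Rightarrow> real \<Rightarrow> bool" where
  "S_bound L p K \<longleftrightarrow> 0 \<le> p \<and> 0 \<le> K \<and> (\<forall>\<xi>\<in>S_space \<theta>. cmod (L \<xi>) \<le> K * S_norm \<theta> p \<xi>)"

text \<open>The neighbourhood contains a ball of some norm about zero; rescaling an arbitrary test
  function into that ball gives the bound with constant \<open>1 / r\<close>.\<close>

lemma S_linear_bounded:
  assumes L: "S_linear L" and U: "openin (S_topology \<theta>) U" "(\<lambda>\<omega>. 0) \<in> U"
    and le: "\<And>\<xi>. \<xi> \<in> U \<Longrightarrow> cmod (L \<xi>) \<le> 1"
  shows "\<exists>p K. S_bound L p K"
proof -
  obtain p r where pr: "p \<ge> 0" "r > 0" "S_ball p (\<lambda>\<omega>. 0) r \<subseteq> U"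
    using U(2) U(1)[unfolded openin_S_topology] by blast
  have "cmod (L \<xi>) \<le> 1 / r * S_norm \<theta> p \<xi>" if \<xi>: "\<xi> \<in> S_space \<theta>" for \<xi>
  proof (rule field_le_epsilon)
    fix e :: real assume e: "0 < e"
    \<comment> \<open>The norm of \<open>\<xi>\<close> may be 0 and so cannot serve as a divisor.
      The surplus \<open>e * r\<close> makes \<open>t\<close> positive and costs exactly
      \<open>e\<close> after division by \<open>r\<close>.\<close>
    define t where "t = S_norm \<theta> p \<xi> + e * r"
    have t: "0 < t" "S_norm \<theta> p \<xi> < t"
      using e pr S_norm_nonneg[of \<theta> p \<xi>] by (auto simp: t_def intro: add_nonneg_pos)
    have "S_norm \<theta> p (\<lambda>\<omega>. complex_of_real (r / t) * \<xi> \<omega>) = r / t * S_norm \<theta> p \<xi>"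
      unfolding S_norm_scale using pr t by (simp add: norm_divide)
    also have "\<dots> < r"
      using pr t by (simp add: field_simps)
    finally have "(\<lambda>\<omega>. complex_of_real (r / t) * \<xi> \<omega>) \<in> S_ball p (\<lambda>\<omega>. 0) r"
      using S_space_scale[OF \<xi>, of "complex_of_real (r / t)"] by (simp add: S_ball_def)
    then have "cmod (L (\<lambda>\<omega>. complex_of_real (r / t) * \<xi> \<omega>)) \<le> 1"
      using pr le by blast
    also have "L (\<lambda>\<omega>. complex_of_real (r / t) * \<xi> \<omega>) = complex_of_real (r / t) * L \<xi>"
      by (intro S_linear_scale L \<xi>)
    finally have "r * cmod (L \<xi>) \<le> t"
      using pr t by (simp add: norm_mult norm_divide divide_simps)
    then show "cmod (L \<xi>) \<le> 1 / r * S_norm \<theta> p \<xi> + e"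
      using pr by (simp add: t_def field_simps)
  qed
  then have "S_bound L p (1 / r)"
    using pr by (simp add: S_bound_def)
  then show ?thesis
    by blast
qed

text \<open>The error of a partial sum is \<open>L\<close> applied to the remainder of
  \<open>\<xi>\<close>, which the dominating norm sends to 0.\<close>

lemma S_linear_expansion:
  assumes L: "S_linear L" "S_bound L p K" and \<xi>: "\<xi> \<in> S_space \<theta>"
  shows "((\<lambda>\<sigma>. coeff \<xi> \<sigma> * L (Z \<theta> \<sigma>)) has_sum L \<xi>) FS"
  unfolding has_sum_def
proof (rule LIM_zero_cancel, rule Lim_null_comparison)
  have p: "0 \<le> p"
    using L by (simp add: S_bound_def)
  show "((\<lambda>F. K * S_norm \<theta> p (\<lambda>\<omega>. \<xi> \<omega> - partial_sum \<xi> F \<omega>)) \<longlongrightarrow> 0) (finite_subsets_at_top FS)"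
    using tendsto_mult_right_zero[OF partial_sum_tendsto[OF \<xi> p]] .
  show "\<forall>\<^sub>F F in finite_subsets_at_top FS.
      norm ((\<Sum>\<sigma>\<in>F. coeff \<xi> \<sigma> * L (Z \<theta> \<sigma>)) - L \<xi>)
        \<le> K * S_norm \<theta> p (\<lambda>\<omega>. \<xi> \<omega> - partial_sum \<xi> F \<omega>)"
  proof (rule eventually_finite_subsets_at_top_weakI)
    fix F assume F: "finite F" "F \<subseteq> FS"
    have "L (\<lambda>\<omega>. \<xi> \<omega> - partial_sum \<xi> F \<omega>) = L \<xi> - (\<Sum>\<sigma>\<in>F. coeff \<xi> \<sigma> * L (Z \<theta> \<sigma>))"
      unfolding S_linear_diff[OF L(1) \<xi> partial_sum_S_space[OF F(2)]]
      unfolding partial_sum_def using F L(1) by (subst S_linear_sum) (auto intro: Z_S_space)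
    moreover have "cmod (L (\<lambda>\<omega>. \<xi> \<omega> - partial_sum \<xi> F \<omega>))
        \<le> K * S_norm \<theta> p (\<lambda>\<omega>. \<xi> \<omega> - partial_sum \<xi> F \<omega>)"
      using L(2) S_space_diff[OF \<xi> partial_sum_S_space[OF F(2)]] by (simp add: S_bound_def)
    ultimately show "norm ((\<Sum>\<sigma>\<in>F. coeff \<xi> \<sigma> * L (Z \<theta> \<sigma>)) - L \<xi>)
        \<le> K * S_norm \<theta> p (\<lambda>\<omega>. \<xi> \<omega> - partial_sum \<xi> F \<omega>)"
      by (metis norm_minus_commute)
  qed
qed

section \<open>Absolutely convergent bilinear forms with a given matrix\<close>

text \<open>All index sets in \<open>F\<close> are subsets of some initial segment, and expanding
  the product of the factors \<open>1 + 1 / (1 + k)\<^sup>2\<close> over that segment produces one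
  term per subset.\<close>

lemma sum_inverse_lam_le:
  assumes "finite F" "F \<subseteq> FS"
  shows "(\<Sum>\<sigma>\<in>F. (1 / lam \<sigma>)\<^sup>2) \<le> 4"
proof -
  have "finite (\<Union>F)"
    using assms by auto
  then obtain m where m: "\<Union>F \<subseteq> {..<m}"
    using finite_nat_bounded by blast
  \<comment> \<open>The successor ensures that the segment is nonempty, as the product bound
    demands.\<close>
  define n where "n = Suc m"
  have n: "F \<subseteq> Pow {..<n}" "1 \<le> n"
    using m by (auto simp: n_def)
  have "(\<Sum>\<sigma>\<in>F. (1 / lam \<sigma>)\<^sup>2) \<le> (\<Sum>\<sigma>\<in>Pow {..<n}. (1 / lam \<sigma>)\<^sup>2)"
    using n by (intro sum_mono2) auto
  also have "\<dots> = (\<Prod>k<n. (1 / (1 + real k))\<^sup>2 + 1)"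
    by (subst prod_add) (simp_all add: lam_def prod_dividef prod_power_distrib power_one_over)
  also have "\<dots> \<le> 4 * real n / (real n + 1)"
    using n by (intro prod_inverse_square_le)
  also have "\<dots> \<le> 4"
    by (simp add: divide_le_eq)
  finally show ?thesis .
qed

text \<open>Raising the exponent by one frees a factor \<open>1 / lam \<sigma>\<close>.
  Cauchy-Schwarz applies to the two families, and 2 is the square root of the bound 4 for the
  squares of these factors.\<close>

lemma sum_S_weight_root_le:
  assumes \<xi>: "\<xi> \<in> S_space \<theta>" and "0 \<le> p" and F: "finite F" "F \<subseteq> FS"
  shows "(\<Sum>\<sigma>\<in>F. S_weight_root \<theta> p \<xi> \<sigma>) \<le> 2 * S_norm \<theta> (p + 1) \<xi>"
proof -
  have "S_weight_root \<theta> p \<xi> \<sigma> = \<bar>S_weight_root \<theta> (p + 1) \<xi> \<sigma>\<bar> * \<bar>1 / lam \<sigma>\<bar>" for \<sigma>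
    using lam_ge_1[of \<sigma>] by (simp add: S_weight_root_def powr_add abs_mult)
  then have "(\<Sum>\<sigma>\<in>F. S_weight_root \<theta> p \<xi> \<sigma>)
      \<le> L2_set (S_weight_root \<theta> (p + 1) \<xi>) F * L2_set (\<lambda>\<sigma>. 1 / lam \<sigma>) F"
    using L2_set_mult_ineq[of "S_weight_root \<theta> (p + 1) \<xi>" "\<lambda>\<sigma>. 1 / lam \<sigma>" F] by simp
  also have "\<dots> \<le> S_norm \<theta> (p + 1) \<xi> * 2"
  proof (intro mult_mono L2_set_le_S_norm F)
    show "\<xi> \<in> S_level \<theta> (p + 1)"
      using \<xi> \<open>0 \<le> p\<close> by (simp add: S_space_def)
    show "L2_set (\<lambda>\<sigma>. 1 / lam \<sigma>) F \<le> 2"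
      unfolding L2_set_def using real_sqrt_le_mono[OF sum_inverse_lam_le[OF F]] by simp
  qed (simp_all add: S_norm_nonneg L2_set_nonneg)
  finally show ?thesis
    by simp
qed

text \<open>The condition that characterises 2D-Fock transforms of continuous operators.\<close>

definition growth :: "(nat set \<Rightarrow> nat set \<Rightarrow> complex) \<Rightarrow> real \<Rightarrow> real \<Rightarrow> bool" where
  "growth G C p \<longleftrightarrow> 0 \<le> C \<and> 0 \<le> p \<and>
     (\<forall>\<sigma> \<tau>. finite \<sigma> \<longrightarrow> finite \<tau> \<longrightarrow> cmod (G \<sigma> \<tau>) \<le> C * lam \<sigma> powr p * lam \<tau> powr p)"

definition kernel_term ::
    "(nat set \<Rightarrow> nat set \<Rightarrow> complex) \<Rightarrow> cfun \<Rightarrow> cfun \<Rightarrow> nat set \<times> nat set \<Rightarrow> complex" where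
  "kernel_term G \<xi> \<eta> = (\<lambda>(\<sigma>, \<tau>). coeff \<xi> \<sigma> * coeff \<eta> \<tau> * G \<sigma> \<tau>)"

text \<open>Bilinear rather than sesquilinear, like the pairing of functionals with test functions.
  The value of \<open>infsum\<close> is 0 for a family that is not summable; \<open>growth\<close>
  excludes this case on test functions.\<close>

definition kernel_form :: "(nat set \<Rightarrow> nat set \<Rightarrow> complex) \<Rightarrow> cfun \<Rightarrow> cfun \<Rightarrow> complex" where
  "kernel_form G \<xi> \<eta> = infsum (kernel_term G \<xi> \<eta>) (FS \<times> FS)"

lemma sum_kernel_term_le:
  assumes G: "growth G C p" and \<xi>: "\<xi> \<in> S_space \<theta>" and \<eta>: "\<eta> \<in> S_space \<theta>"
    and F: "finite F" "F \<subseteq> FS \<times> FS"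
  shows "(\<Sum>x\<in>F. cmod (kernel_term G \<xi> \<eta> x))
    \<le> 4 * C * S_norm \<theta> (p + 1) \<xi> * S_norm \<theta> (p + 1) \<eta>"
proof -
  let ?u = "S_weight_root \<theta> p \<xi>" and ?v = "S_weight_root \<theta> p \<eta>"
  have Cp: "0 \<le> C" "0 \<le> p"
    using G by (auto simp: growth_def)
  have nn: "0 \<le> ?u \<sigma>" "0 \<le> ?v \<sigma>" for \<sigma>
    by (auto simp: S_weight_root_def)
  have sub: "fst ` F \<subseteq> FS" "snd ` F \<subseteq> FS"
    using F by auto
  have "cmod (kernel_term G \<xi> \<eta> (\<sigma>, \<tau>)) \<le> C * (?u \<sigma> * ?v \<tau>)" if "(\<sigma>, \<tau>) \<in> F" for \<sigma> \<tau>
  proof -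
    have "cmod (G \<sigma> \<tau>) \<le> C * lam \<sigma> powr p * lam \<tau> powr p"
      using G F that by (auto simp: growth_def)
    then have "cmod (coeff \<xi> \<sigma> * coeff \<eta> \<tau>) * cmod (G \<sigma> \<tau>)
        \<le> cmod (coeff \<xi> \<sigma> * coeff \<eta> \<tau>) * (C * lam \<sigma> powr p * lam \<tau> powr p)"
      by (intro mult_left_mono) auto
    then show ?thesis
      by (simp add: kernel_term_def S_weight_root_def norm_mult mult_ac)
  qed
  then have "(\<Sum>x\<in>F. cmod (kernel_term G \<xi> \<eta> x)) \<le> (\<Sum>(\<sigma>, \<tau>)\<in>F. C * (?u \<sigma> * ?v \<tau>))"
    by (intro sum_mono) auto
  \<comment> \<open>The majorant is nonnegative, so \<open>F\<close> may be enlarged to the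
    rectangle of its projections, over which the sum factorises. Each factor then contributes a
    constant 2.\<close>
  also have "\<dots> \<le> (\<Sum>(\<sigma>, \<tau>)\<in>fst ` F \<times> snd ` F. C * (?u \<sigma> * ?v \<tau>))"
    using F Cp nn by (intro sum_mono2) (force intro!: mult_nonneg_nonneg)+
  also have "\<dots> = C * ((\<Sum>\<sigma>\<in>fst ` F. ?u \<sigma>) * (\<Sum>\<tau>\<in>snd ` F. ?v \<tau>))"
    by (simp only: sum_product sum.cartesian_product) (simp add: sum_distrib_left split_def)
  also have "\<dots> \<le> C * ((2 * S_norm \<theta> (p + 1) \<xi>) * (2 * S_norm \<theta> (p + 1) \<eta>))"
    using F sub Cp nn
    by (intro mult_left_mono mult_mono sum_S_weight_root_le \<xi> \<eta>) (auto intro!: sum_nonneg simp: S_norm_nonneg)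
  finally show ?thesis
    by (simp add: mult_ac)
qed

lemma kernel_term_abs_summable:
  assumes "growth G C p" "\<xi> \<in> S_space \<theta>" "\<eta> \<in> S_space \<theta>"
  shows "(\<lambda>x. cmod (kernel_term G \<xi> \<eta> x)) summable_on FS \<times> FS"
  using sum_kernel_term_le[OF assms]
  by (intro nonneg_bdd_above_summable_on) (auto intro!: bdd_aboveI2)

lemma kernel_term_summable:
  assumes "growth G C p" "\<xi> \<in> S_space \<theta>" "\<eta> \<in> S_space \<theta>"
  shows "kernel_term G \<xi> \<eta> summable_on FS \<times> FS"
  using kernel_term_abs_summable[OF assms] by (rule abs_summable_summable)

lemma kernel_form_le:
  assumes "growth G C p" "\<xi> \<in> S_space \<theta>" "\<eta> \<in> S_space \<theta>"
  shows "cmod (kernel_form G \<xi> \<eta>) \<le> 4 * C * S_norm \<theta> (p + 1) \<xi> * S_norm \<theta> (p + 1) \<eta>"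
  unfolding kernel_form_def
  using norm_infsum_bound[OF kernel_term_abs_summable[OF assms]]
    infsum_le_finite_sums[OF kernel_term_abs_summable[OF assms] sum_kernel_term_le[OF assms]]
  by linarith

lemma kernel_form_linear_right:
  assumes G: "growth G C p" and \<xi>: "\<xi> \<in> S_space \<theta>"
  shows "S_linear (kernel_form G \<xi>)"
  unfolding S_linear_def
proof (intro conjI ballI allI)
  fix \<eta> \<zeta> assume \<eta>: "\<eta> \<in> S_space \<theta>" and \<zeta>: "\<zeta> \<in> S_space \<theta>"
  have "kernel_form G \<xi> (\<lambda>\<omega>. \<eta> \<omega> + \<zeta> \<omega>) =
      infsum (\<lambda>x. kernel_term G \<xi> \<eta> x + kernel_term G \<xi> \<zeta> x) (FS \<times> FS)"
    unfolding kernel_form_def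
    by (rule infsum_cong) (auto simp: kernel_term_def coeff_add S_space_L2 \<eta> \<zeta> algebra_simps)
  then show "kernel_form G \<xi> (\<lambda>\<omega>. \<eta> \<omega> + \<zeta> \<omega>) = kernel_form G \<xi> \<eta> + kernel_form G \<xi> \<zeta>"
    by (simp only: kernel_form_def infsum_add kernel_term_summable[OF G \<xi>] \<eta> \<zeta>)
next
  fix \<eta> c assume \<eta>: "\<eta> \<in> S_space \<theta>"
  have "kernel_form G \<xi> (\<lambda>\<omega>. c * \<eta> \<omega>) = infsum (\<lambda>x. c * kernel_term G \<xi> \<eta> x) (FS \<times> FS)"
    unfolding kernel_form_def
    by (rule infsum_cong) (auto simp: kernel_term_def ip_scale_right)
  then show "kernel_form G \<xi> (\<lambda>\<omega>. c * \<eta> \<omega>) = c * kernel_form G \<xi> \<eta>"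
    by (simp add: kernel_form_def infsum_cmult_right')
qed

lemma kernel_form_linear_left:
  assumes G: "growth G C p" and \<xi>: "\<xi> \<in> S_space \<theta>"
  shows "S_linear (\<lambda>\<eta>. kernel_form G \<eta> \<xi>)"
  unfolding S_linear_def
proof (intro conjI ballI allI)
  fix \<eta> \<zeta> assume \<eta>: "\<eta> \<in> S_space \<theta>" and \<zeta>: "\<zeta> \<in> S_space \<theta>"
  have "kernel_form G (\<lambda>\<omega>. \<eta> \<omega> + \<zeta> \<omega>) \<xi> =
      infsum (\<lambda>x. kernel_term G \<eta> \<xi> x + kernel_term G \<zeta> \<xi> x) (FS \<times> FS)"
    unfolding kernel_form_def
    by (rule infsum_cong) (auto simp: kernel_term_def coeff_add S_space_L2 \<eta> \<zeta> algebra_simps)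
  then show "kernel_form G (\<lambda>\<omega>. \<eta> \<omega> + \<zeta> \<omega>) \<xi> = kernel_form G \<eta> \<xi> + kernel_form G \<zeta> \<xi>"
    by (simp only: kernel_form_def infsum_add kernel_term_summable[OF G _ \<xi>] \<eta> \<zeta>)
next
  fix \<eta> c assume \<eta>: "\<eta> \<in> S_space \<theta>"
  have "kernel_form G (\<lambda>\<omega>. c * \<eta> \<omega>) \<xi> = infsum (\<lambda>x. c * kernel_term G \<eta> \<xi> x) (FS \<times> FS)"
    unfolding kernel_form_def
    by (rule infsum_cong) (auto simp: kernel_term_def ip_scale_right)
  then show "kernel_form G (\<lambda>\<omega>. c * \<eta> \<omega>) \<xi> = c * kernel_form G \<eta> \<xi>"
    by (simp add: kernel_form_def infsum_cmult_right')
qed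

text \<open>Orthonormality leaves a single term of the double sum, so the form has the prescribed
  2D-Fock transform.\<close>

lemma kernel_form_Z:
  assumes "finite \<sigma>" "finite \<tau>"
  shows "kernel_form G (Z \<theta> \<sigma>) (Z \<theta> \<tau>) = G \<sigma> \<tau>"
proof -
  have "kernel_form G (Z \<theta> \<sigma>) (Z \<theta> \<tau>) = infsum (kernel_term G (Z \<theta> \<sigma>) (Z \<theta> \<tau>)) {(\<sigma>, \<tau>)}"
    unfolding kernel_form_def using assms
    by (intro infsum_cong_neutral) (auto simp: kernel_term_def Z_orthonormal)
  also have "\<dots> = G \<sigma> \<tau>"
    using assms by (simp add: kernel_term_def Z_orthonormal)
  finally show ?thesis .
qed

text \<open>Because the \<open>Z\<close> are real, conjugating \<open>\<xi>\<close> conjugates its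
  coefficients. The sums over squares are then the quadratic forms in the hypothesis
  \<open>pos\<close>, and the nonnegative reals are closed.\<close>

lemma kernel_form_cnj_nonneg:
  assumes G: "growth G C p" and \<xi>: "\<xi> \<in> S_space \<theta>"
    and pos: "\<And>F a. finite F \<Longrightarrow> F \<subseteq> FS \<Longrightarrow> (\<Sum>(\<sigma>, \<tau>)\<in>F \<times> F. cnj (a \<sigma>) * a \<tau> * G \<sigma> \<tau>) \<in> \<real>\<^sub>\<ge>\<^sub>0"
  shows "kernel_form G (\<lambda>\<omega>. cnj (\<xi> \<omega>)) \<xi> \<in> \<real>\<^sub>\<ge>\<^sub>0"
proof -
  let ?t = "kernel_term G (\<lambda>\<omega>. cnj (\<xi> \<omega>)) \<xi>"
  have lim: "((\<lambda>F. sum ?t (F \<times> F)) \<longlongrightarrow> infsum ?t (FS \<times> FS)) (finite_subsets_at_top FS)"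
    using filterlim_compose[OF infsum_tendsto[OF kernel_term_summable[OF G S_space_cnj[OF \<xi>] \<xi>]]
        filterlim_Times_finite_subsets] .
  have "sum ?t (F \<times> F) \<in> \<real>\<^sub>\<ge>\<^sub>0" if "finite F" "F \<subseteq> FS" for F
  proof -
    have "?t = (\<lambda>(\<sigma>, \<tau>). cnj (coeff \<xi> \<sigma>) * coeff \<xi> \<tau> * G \<sigma> \<tau>)"
      by (simp add: kernel_term_def coeff_cnj)
    then show ?thesis
      using pos[OF that, of "coeff \<xi>"] by (simp only:)
  qed
  then have ev: "\<forall>\<^sub>F F in finite_subsets_at_top FS. sum ?t (F \<times> F) \<in> \<real>\<^sub>\<ge>\<^sub>0"
    by (rule eventually_finite_subsets_at_top_weakI)
  show ?thesis
    unfolding kernel_form_def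
    by (rule Lim_in_closed_set[OF closed_nonneg_Reals_complex ev finite_subsets_at_top_neq_bot lim])
qed

section \<open>The dual space and operators defined by a matrix\<close>

lemma S_dual_iff:
  "\<Phi> \<in> S_dual \<theta> \<longleftrightarrow>
    \<Phi> \<in> extensional (S_space \<theta>) \<and> S_linear \<Phi> \<and> continuous_map (S_topology \<theta>) euclidean \<Phi>"
  unfolding S_dual_def S_linear_def by simp

lemma S_linear_continuous:
  assumes L: "S_linear L" "S_bound L p K"
  shows "continuous_map (S_topology \<theta>) euclidean L"
  unfolding continuous_map_def
proof (intro conjI allI impI)
  fix V :: "complex set" assume "openin euclidean V"
  then have V: "open V"
    by simp
  have pK: "0 \<le> p" "0 \<le> K"
    using L by (auto simp: S_bound_def)
  let ?U = "{\<xi> \<in> topspace (S_topology \<theta>). L \<xi> \<in> V}"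
  have "\<exists>p\<ge>0. \<exists>r>0. S_ball p \<xi> r \<subseteq> ?U" if "\<xi> \<in> ?U" for \<xi>
  proof -
    have \<xi>: "\<xi> \<in> S_space \<theta>" "L \<xi> \<in> V"
      using that by (auto simp: topspace_S_topology)
    obtain e where e: "0 < e" "ball (L \<xi>) e \<subseteq> V"
      using V \<xi>(2) by (rule openE)
    \<comment> \<open>\<open>K + 1\<close> in place of \<open>K\<close> keeps the radius defined
      when \<open>K = 0\<close> and makes the final estimate strict.\<close>
    have "S_ball p \<xi> (e / (K + 1)) \<subseteq> ?U"
    proof
      fix \<eta> assume "\<eta> \<in> S_ball p \<xi> (e / (K + 1))"
      then have \<eta>: "\<eta> \<in> S_space \<theta>" "S_norm \<theta> p (\<lambda>\<omega>. \<eta> \<omega> - \<xi> \<omega>) < e / (K + 1)"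
        by (auto simp: S_ball_def)
      have "cmod (L \<eta> - L \<xi>) = cmod (L (\<lambda>\<omega>. \<eta> \<omega> - \<xi> \<omega>))"
        by (simp only: S_linear_diff[OF L(1) \<eta>(1) \<xi>(1)])
      also have "\<dots> \<le> K * S_norm \<theta> p (\<lambda>\<omega>. \<eta> \<omega> - \<xi> \<omega>)"
        using L(2) S_space_diff[OF \<eta>(1) \<xi>(1)] by (simp add: S_bound_def)
      also have "\<dots> \<le> K * (e / (K + 1))"
        using \<eta> pK by (intro mult_left_mono) auto
      also have "\<dots> < e"
        using e pK by (simp add: field_simps)
      finally have "L \<eta> \<in> ball (L \<xi>) e"
        by (simp add: dist_norm norm_minus_commute)
      then show "\<eta> \<in> ?U"
        using e \<eta> by (auto simp: topspace_S_topology)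
    qed
    then show ?thesis
      using pK e by (intro exI[of _ p] conjI exI[of _ "e / (K + 1)"]) auto
  qed
  then show "openin (S_topology \<theta>) ?U"
    unfolding openin_S_topology by (auto simp: topspace_S_topology)
qed simp

lemma S_dual_bound:
  assumes "\<Phi> \<in> S_dual \<theta>"
  shows "\<exists>p K. S_bound \<Phi> p K"
proof (rule S_linear_bounded)
  show lin: "S_linear \<Phi>"
    using assms by (simp add: S_dual_iff)
  let ?U = "{\<xi> \<in> topspace (S_topology \<theta>). \<Phi> \<xi> \<in> ball 0 1}"
  have "continuous_map (S_topology \<theta>) euclidean \<Phi>"
    using assms by (simp add: S_dual_iff)
  then show "openin (S_topology \<theta>) ?U"
    by (rule openin_continuous_map_preimage) simp
  show "(\<lambda>\<omega>. 0) \<in> ?U"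
    by (simp add: topspace_S_topology S_space_zero S_linear_zero[OF lin])
  show "cmod (\<Phi> \<xi>) \<le> 1" if "\<xi> \<in> ?U" for \<xi>
    using that by simp
qed

lemma S_dual_bounded_on:
  assumes "\<Phi> \<in> S_dual \<theta>" "S_bounded \<theta> B"
  shows "\<exists>R. \<forall>\<xi>\<in>B. cmod (\<Phi> \<xi>) \<le> R"
proof -
  obtain p K where pK: "S_bound \<Phi> p K"
    using S_dual_bound[OF assms(1)] by (elim exE)
  then have "bdd_above (S_norm \<theta> p ` B)"
    using assms(2) by (simp add: S_bound_def S_bounded_def)
  then obtain R where R: "\<And>\<xi>. \<xi> \<in> B \<Longrightarrow> S_norm \<theta> p \<xi> \<le> R"
    unfolding bdd_above_def by auto
  have "cmod (\<Phi> \<xi>) \<le> K * R" if "\<xi> \<in> B" for \<xi>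
  proof -
    have "cmod (\<Phi> \<xi>) \<le> K * S_norm \<theta> p \<xi>"
      using pK assms(2) that by (auto simp: S_bound_def S_bounded_def)
    also have "\<dots> \<le> K * R"
      using R[OF that] pK by (intro mult_left_mono) (auto simp: S_bound_def)
    finally show ?thesis .
  qed
  then show ?thesis
    by (intro exI[of _ "K * R"]) simp
qed

text \<open>This makes the suprema in the strong topology genuine upper bounds of the differences
  over \<open>B\<close>.\<close>

lemma S_dual_diff_bdd_above:
  assumes "\<Phi> \<in> S_dual \<theta>" "\<Psi> \<in> S_dual \<theta>" "S_bounded \<theta> B"
  shows "bdd_above ((\<lambda>\<xi>. cmod (\<Phi> \<xi> - \<Psi> \<xi>)) ` B)"
proof -
  obtain R where R: "\<forall>\<xi>\<in>B. cmod (\<Phi> \<xi>) \<le> R"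
    using S_dual_bounded_on[OF assms(1,3)] by (elim exE)
  obtain Q where Q: "\<forall>\<xi>\<in>B. cmod (\<Psi> \<xi>) \<le> Q"
    using S_dual_bounded_on[OF assms(2,3)] by (elim exE)
  show ?thesis
  proof (rule bdd_aboveI2)
    fix \<xi> assume "\<xi> \<in> B"
    then show "cmod (\<Phi> \<xi> - \<Psi> \<xi>) \<le> R + Q"
      using R Q norm_triangle_ineq4[of "\<Phi> \<xi>" "\<Psi> \<xi>"] by force
  qed
qed

text \<open>Both arguments are restricted because operators and functionals are represented
  extensionally.\<close>

definition kernel_op :: "(nat set \<Rightarrow> nat set \<Rightarrow> complex) \<Rightarrow> cfun \<Rightarrow> cfun \<Rightarrow> complex" where
  "kernel_op G = (\<lambda>\<xi>\<in>S_space \<theta>. \<lambda>\<eta>\<in>S_space \<theta>. kernel_form G \<xi> \<eta>)"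

lemma kernel_op_S_dual:
  assumes G: "growth G C p" and \<xi>: "\<xi> \<in> S_space \<theta>"
  shows "kernel_op G \<xi> \<in> S_dual \<theta>"
proof -
  have bound: "S_bound (kernel_form G \<xi>) (p + 1) (4 * C * S_norm \<theta> (p + 1) \<xi>)"
    using G kernel_form_le[OF G \<xi>] by (simp add: S_bound_def growth_def S_norm_nonneg)
  have "continuous_map (S_topology \<theta>) euclidean (kernel_op G \<xi>)"
    by (rule continuous_map_eq[OF S_linear_continuous[OF kernel_form_linear_right[OF G \<xi>] bound]])
      (simp add: topspace_S_topology kernel_op_def \<xi>)
  moreover have "S_linear (kernel_op G \<xi>)"
    using kernel_form_linear_right[OF G \<xi>] \<xi>
    by (simp add: S_linear_def kernel_op_def S_space_add S_space_scale)
  moreover have "kernel_op G \<xi> \<in> extensional (S_space \<theta>)"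
    by (simp add: kernel_op_def \<xi>)
  ultimately show ?thesis
    by (simp add: S_dual_iff)
qed

text \<open>On a bounded set the norm of the second argument is at most some \<open>R\<close>, so
  \<open>kernel_form_le\<close> is a Lipschitz estimate in the first argument, uniform over that
  set.\<close>

lemma kernel_op_continuous:
  assumes G: "growth G C p"
  shows "continuous_map (S_topology \<theta>) (S_dual_topology \<theta>) (kernel_op G)"
  unfolding S_dual_topology_def
proof (rule continuous_on_generated_topo)
  fix U assume "U \<in> {{\<Psi> \<in> S_dual \<theta>. (SUP \<xi>\<in>B. cmod (\<Psi> \<xi> - \<Phi> \<xi>)) < r} | \<Phi> B r.
        \<Phi> \<in> S_dual \<theta> \<and> S_bounded \<theta> B \<and> B \<noteq> {} \<and> 0 < r}"
  then obtain \<Phi> B r where U: "U = {\<Psi> \<in> S_dual \<theta>. (SUP \<xi>\<in>B. cmod (\<Psi> \<xi> - \<Phi> \<xi>)) < r}"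
    and \<Phi>: "\<Phi> \<in> S_dual \<theta>" and B: "S_bounded \<theta> B" "B \<noteq> {}"
    by auto
  have Cp: "0 \<le> C" "0 \<le> p"
    using G by (auto simp: growth_def)
  have "bdd_above (S_norm \<theta> (p + 1) ` B)"
    using B Cp by (simp add: S_bounded_def)
  then obtain R where R: "\<And>\<xi>. \<xi> \<in> B \<Longrightarrow> S_norm \<theta> (p + 1) \<xi> \<le> R"
    unfolding bdd_above_def by auto
  have "0 \<le> R"
    using B(2) R S_norm_nonneg by (metis all_not_in_conv order_trans)
  let ?V = "kernel_op G -` U \<inter> topspace (S_topology \<theta>)"
  have "\<exists>p\<ge>0. \<exists>r>0. S_ball p \<xi> r \<subseteq> ?V" if "\<xi> \<in> ?V" for \<xi>
  proof -
    define s where "s = (SUP \<eta>\<in>B. cmod (kernel_op G \<xi> \<eta> - \<Phi> \<eta>))"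
    have \<xi>: "\<xi> \<in> S_space \<theta>" and s: "s < r"
      using that by (auto simp: topspace_S_topology U s_def)
    \<comment> \<open>Half of the gap is used because passing to the supremum yields only a weak
      inequality, while \<open>s + d < r\<close> remains strict.\<close>
    define d where "d = (r - s) / 2"
    \<comment> \<open>The Lipschitz constant \<open>4 * C * R\<close> can be 0; adding 1 allows
      division by it.\<close>
    define D where "D = 4 * C * R + 1"
    have d: "0 < d" and D: "0 < D"
      using s Cp \<open>0 \<le> R\<close> by (auto simp: d_def D_def add_nonneg_pos)
    have "S_ball (p + 1) \<xi> (d / D) \<subseteq> ?V"
    proof
      fix \<eta> assume "\<eta> \<in> S_ball (p + 1) \<xi> (d / D)"
      then have \<eta>: "\<eta> \<in> S_space \<theta>" "S_norm \<theta> (p + 1) (\<lambda>\<omega>. \<eta> \<omega> - \<xi> \<omega>) < d / D"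
        by (auto simp: S_ball_def)
      have "cmod (kernel_op G \<eta> \<zeta> - \<Phi> \<zeta>) \<le> s + d" if \<zeta>: "\<zeta> \<in> B" for \<zeta>
      proof -
        have \<zeta>S: "\<zeta> \<in> S_space \<theta>"
          using B \<zeta> by (auto simp: S_bounded_def)
        have "kernel_op G \<eta> \<zeta> - kernel_op G \<xi> \<zeta> = kernel_form G (\<lambda>\<omega>. \<eta> \<omega> - \<xi> \<omega>) \<zeta>"
          using S_linear_diff[OF kernel_form_linear_left[OF G \<zeta>S] \<eta>(1) \<xi>] \<eta> \<xi> \<zeta>S
          by (simp add: kernel_op_def)
        also have "cmod \<dots> \<le> 4 * C * S_norm \<theta> (p + 1) (\<lambda>\<omega>. \<eta> \<omega> - \<xi> \<omega>) * S_norm \<theta> (p + 1) \<zeta>"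
          by (rule kernel_form_le[OF G S_space_diff[OF \<eta>(1) \<xi>] \<zeta>S])
        also have "\<dots> \<le> 4 * C * (d / D) * R"
          using \<eta> R[OF \<zeta>] Cp D d \<open>0 \<le> R\<close>
          by (intro mult_mono mult_nonneg_nonneg) (auto simp: S_norm_nonneg)
        also have "\<dots> = d * ((4 * C * R) / D)"
          by simp
        also have "\<dots> \<le> d * 1"
          using D d by (intro mult_left_mono) (auto simp: D_def)
        finally have "cmod (kernel_op G \<eta> \<zeta> - kernel_op G \<xi> \<zeta>) \<le> d"
          by simp
        moreover have "cmod (kernel_op G \<xi> \<zeta> - \<Phi> \<zeta>) \<le> s"
          unfolding s_def
          by (rule cSUP_upper[OF \<zeta> S_dual_diff_bdd_above[OF kernel_op_S_dual[OF G \<xi>] \<Phi> B(1)]])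
        moreover have "cmod (kernel_op G \<eta> \<zeta> - \<Phi> \<zeta>)
            \<le> cmod (kernel_op G \<eta> \<zeta> - kernel_op G \<xi> \<zeta>) + cmod (kernel_op G \<xi> \<zeta> - \<Phi> \<zeta>)"
          using norm_triangle_ineq[of "kernel_op G \<eta> \<zeta> - kernel_op G \<xi> \<zeta>" "kernel_op G \<xi> \<zeta> - \<Phi> \<zeta>"]
          by simp
        ultimately show ?thesis
          by linarith
      qed
      then have "(SUP \<zeta>\<in>B. cmod (kernel_op G \<eta> \<zeta> - \<Phi> \<zeta>)) \<le> s + d"
        by (rule cSUP_least[OF B(2)])
      also have "\<dots> < r"
        using s by (simp add: d_def field_simps)
      finally show "\<eta> \<in> ?V"
        using \<eta>(1) kernel_op_S_dual[OF G \<eta>(1)] by (simp add: U topspace_S_topology)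
    qed
    then show ?thesis
      using Cp d D by (intro exI[of _ "p + 1"] conjI exI[of _ "d / D"]) auto
  qed
  then show "openin (S_topology \<theta>) ?V"
    unfolding openin_S_topology by (auto simp: topspace_S_topology)
next
  show "kernel_op G ` topspace (S_topology \<theta>) \<subseteq>
    \<Union> {{\<Psi> \<in> S_dual \<theta>. (SUP \<xi>\<in>B. cmod (\<Psi> \<xi> - \<Phi> \<xi>)) < r} | \<Phi> B r.
        \<Phi> \<in> S_dual \<theta> \<and> S_bounded \<theta> B \<and> B \<noteq> {} \<and> 0 < r}"
  proof (rule image_subsetI)
    fix \<xi> assume "\<xi> \<in> topspace (S_topology \<theta>)"
    then have \<xi>: "kernel_op G \<xi> \<in> S_dual \<theta>"
      by (intro kernel_op_S_dual[OF G]) (simp add: topspace_S_topology)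
    show "kernel_op G \<xi> \<in>
      \<Union> {{\<Psi> \<in> S_dual \<theta>. (SUP \<xi>\<in>B. cmod (\<Psi> \<xi> - \<Phi> \<xi>)) < r} | \<Phi> B r.
        \<Phi> \<in> S_dual \<theta> \<and> S_bounded \<theta> B \<and> B \<noteq> {} \<and> 0 < r}"
    proof (rule UnionI)
      \<comment> \<open>The generated topology lives on the union of its subbasis, so each value
        needs some subbasic set around it. Centring at the value itself and testing on the zero
        function suffices.\<close>
      let ?B = "{\<lambda>\<omega>. 0 :: complex}"
      show "{\<Psi> \<in> S_dual \<theta>. (SUP \<eta>\<in>?B. cmod (\<Psi> \<eta> - kernel_op G \<xi> \<eta>)) < 1} \<in>
        {{\<Psi> \<in> S_dual \<theta>. (SUP \<xi>\<in>B. cmod (\<Psi> \<xi> - \<Phi> \<xi>)) < r} | \<Phi> B r.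
          \<Phi> \<in> S_dual \<theta> \<and> S_bounded \<theta> B \<and> B \<noteq> {} \<and> 0 < r}"
      proof (intro CollectI exI conjI)
        show "S_bounded \<theta> ?B"
          by (simp add: S_bounded_def S_space_zero)
      qed (rule refl \<xi> insert_not_empty zero_less_one)+
      show "kernel_op G \<xi> \<in> {\<Psi> \<in> S_dual \<theta>. (SUP \<eta>\<in>?B. cmod (\<Psi> \<eta> - kernel_op G \<xi> \<eta>)) < 1}"
        using \<xi> by simp
    qed
  qed
qed

lemma kernel_op_S_operators:
  assumes G: "growth G C p"
  shows "kernel_op G \<in> S_operators \<theta>"
proof -
  have "kernel_op G \<in> S_space \<theta> \<rightarrow>\<^sub>E S_dual \<theta>"
  proof (rule PiE_I)
    show "kernel_op G \<xi> = undefined" if "\<xi> \<notin> S_space \<theta>" for \<xi>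
      using that by (simp add: kernel_op_def)
  qed (rule kernel_op_S_dual[OF G])
  moreover have "kernel_op G (\<lambda>\<omega>. \<xi> \<omega> + \<eta> \<omega>) \<zeta> = kernel_op G \<xi> \<zeta> + kernel_op G \<eta> \<zeta>"
    if "\<xi> \<in> S_space \<theta>" "\<eta> \<in> S_space \<theta>" "\<zeta> \<in> S_space \<theta>" for \<xi> \<eta> \<zeta>
    using S_linear_add[OF kernel_form_linear_left[OF G that(3)] that(1,2)] that
    by (simp add: kernel_op_def S_space_add)
  moreover have "kernel_op G (\<lambda>\<omega>. c * \<xi> \<omega>) \<zeta> = c * kernel_op G \<xi> \<zeta>"
    if "\<xi> \<in> S_space \<theta>" "\<zeta> \<in> S_space \<theta>" for \<xi> \<zeta> c
    using S_linear_scale[OF kernel_form_linear_left[OF G that(2)] that(1)] that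
    by (simp add: kernel_op_def S_space_scale)
  ultimately show ?thesis
    using kernel_op_continuous[OF G] by (simp add: S_operators_def)
qed

section \<open>Uniqueness of an operator with given 2D-Fock transform\<close>

text \<open>A singleton is a bounded set, so evaluation at \<open>\<eta>\<close> is continuous for
  the strong topology, and \<open>T\<close> followed by it is a continuous linear
  functional.\<close>

lemma S_operators_apply_linear:
  assumes T: "T \<in> S_operators \<theta>" and \<eta>: "\<eta> \<in> S_space \<theta>"
  shows "S_linear (\<lambda>\<xi>. T \<xi> \<eta>)" and "\<exists>p K. S_bound (\<lambda>\<xi>. T \<xi> \<eta>) p K"
proof -
  show lin: "S_linear (\<lambda>\<xi>. T \<xi> \<eta>)"
    using T \<eta> by (simp add: S_operators_def S_linear_def)
  have dual: "T \<xi> \<in> S_dual \<theta>" if "\<xi> \<in> S_space \<theta>" for \<xi>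
    using T that by (auto simp: S_operators_def)
  let ?z = "\<lambda>\<omega>. 0 :: complex"
  \<comment> \<open>For a singleton the supremum is one value, and \<open>T\<close> of the zero
    function vanishes at \<open>\<eta>\<close>; membership of \<open>T \<xi>\<close> in
    \<open>V\<close> thus bounds \<open>cmod (T \<xi> \<eta>)\<close> by 1.\<close>
  define V where "V = {\<Psi> \<in> S_dual \<theta>. (SUP \<zeta>\<in>{\<eta>}. cmod (\<Psi> \<zeta> - T ?z \<zeta>)) < 1}"
  have "openin (S_dual_topology \<theta>) V"
    unfolding S_dual_topology_def
  proof (rule topology_generated_by_Basis)
    show "V \<in> {{\<Psi> \<in> S_dual \<theta>. (SUP \<xi>\<in>B. cmod (\<Psi> \<xi> - \<Phi> \<xi>)) < r} | \<Phi> B r.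
        \<Phi> \<in> S_dual \<theta> \<and> S_bounded \<theta> B \<and> B \<noteq> {} \<and> 0 < r}"
      unfolding V_def
    proof (intro CollectI exI conjI)
      show "S_bounded \<theta> {\<eta>}"
        using \<eta> by (simp add: S_bounded_def)
    qed (rule refl dual S_space_zero insert_not_empty zero_less_one)+
  qed
  moreover have "continuous_map (S_topology \<theta>) (S_dual_topology \<theta>) T"
    using T by (simp add: S_operators_def)
  ultimately have U: "openin (S_topology \<theta>) {\<xi> \<in> topspace (S_topology \<theta>). T \<xi> \<in> V}"
    by (intro openin_continuous_map_preimage)
  show "\<exists>p K. S_bound (\<lambda>\<xi>. T \<xi> \<eta>) p K"
  proof (rule S_linear_bounded[OF lin U])
    show "?z \<in> {\<xi> \<in> topspace (S_topology \<theta>). T \<xi> \<in> V}"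
      by (simp add: topspace_S_topology V_def dual S_space_zero)
    show "cmod (T \<xi> \<eta>) \<le> 1" if "\<xi> \<in> {\<xi> \<in> topspace (S_topology \<theta>). T \<xi> \<in> V}" for \<xi>
      using that by (simp add: V_def S_linear_zero[OF lin])
  qed
qed

text \<open>The basis expansion is used twice: in the second argument with the first one fixed at a
  basis vector, then in the first argument with the second one arbitrary.\<close>

lemma S_operators_eqI:
  assumes T: "T \<in> S_operators \<theta>" and T': "T' \<in> S_operators \<theta>"
    and eq: "\<And>\<sigma> \<tau>. finite \<sigma> \<Longrightarrow> finite \<tau> \<Longrightarrow> T (Z \<theta> \<sigma>) (Z \<theta> \<tau>) = T' (Z \<theta> \<sigma>) (Z \<theta> \<tau>)"
  shows "T = T'"
proof -
  have dual: "T \<xi> \<in> S_dual \<theta>" "T' \<xi> \<in> S_dual \<theta>" if "\<xi> \<in> S_space \<theta>" for \<xi>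
    using T T' that by (auto simp: S_operators_def)
  \<comment> \<open>Bounded linear functionals that agree on all \<open>Z\<close> have the same
    expansion, and limits of sums are unique.\<close>
  have cong: "L \<xi> = L' \<xi>"
    if L: "S_linear L" "\<exists>p K. S_bound L p K" and L': "S_linear L'" "\<exists>p K. S_bound L' p K"
      and \<xi>: "\<xi> \<in> S_space \<theta>" and eq: "\<And>\<sigma>. finite \<sigma> \<Longrightarrow> L (Z \<theta> \<sigma>) = L' (Z \<theta> \<sigma>)" for L L' \<xi>
  proof -
    obtain p K where "S_bound L p K"
      using L(2) by (elim exE)
    then have 1: "((\<lambda>\<sigma>. coeff \<xi> \<sigma> * L (Z \<theta> \<sigma>)) has_sum L \<xi>) FS"
      by (intro S_linear_expansion L \<xi>)
    obtain p K where "S_bound L' p K"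
      using L'(2) by (elim exE)
    then have "((\<lambda>\<sigma>. coeff \<xi> \<sigma> * L' (Z \<theta> \<sigma>)) has_sum L' \<xi>) FS"
      by (intro S_linear_expansion L' \<xi>)
    also have "?this \<longleftrightarrow> ((\<lambda>\<sigma>. coeff \<xi> \<sigma> * L (Z \<theta> \<sigma>)) has_sum L' \<xi>) FS"
      by (intro has_sum_cong) (simp add: eq)
    finally show ?thesis
      using 1 by (intro has_sum_unique)
  qed
  have Z: "T (Z \<theta> \<sigma>) \<eta> = T' (Z \<theta> \<sigma>) \<eta>" if \<sigma>: "finite \<sigma>" and \<eta>: "\<eta> \<in> S_space \<theta>" for \<sigma> \<eta>
  proof (rule cong[of "T (Z \<theta> \<sigma>)" "T' (Z \<theta> \<sigma>)" \<eta>])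
    show "S_linear (T (Z \<theta> \<sigma>))" "S_linear (T' (Z \<theta> \<sigma>))"
      using dual[OF Z_S_space[OF \<sigma>]] by (simp_all add: S_dual_iff)
    show "\<exists>p K. S_bound (T (Z \<theta> \<sigma>)) p K" "\<exists>p K. S_bound (T' (Z \<theta> \<sigma>)) p K"
      by (rule S_dual_bound, rule dual, rule Z_S_space, rule \<sigma>)+
    show "T (Z \<theta> \<sigma>) (Z \<theta> \<tau>) = T' (Z \<theta> \<sigma>) (Z \<theta> \<tau>)" if "finite \<tau>" for \<tau>
      using \<sigma> that by (rule eq)
  qed (rule \<eta>)
  have "T \<xi> \<eta> = T' \<xi> \<eta>" if \<xi>: "\<xi> \<in> S_space \<theta>" and \<eta>: "\<eta> \<in> S_space \<theta>" for \<xi> \<eta>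
    using cong[of "\<lambda>\<xi>. T \<xi> \<eta>" "\<lambda>\<xi>. T' \<xi> \<eta>" \<xi>, OF S_operators_apply_linear[OF T \<eta>]
        S_operators_apply_linear[OF T' \<eta>] \<xi> Z[OF _ \<eta>]] by simp
  \<comment> \<open>Agreement on test functions becomes equality of functions by extensionality,
    first for each functional and then for the operators.\<close>
  then have "T \<xi> = T' \<xi>" if "\<xi> \<in> S_space \<theta>" for \<xi>
    using dual[OF that] that by (intro extensionalityI[of _ "S_space \<theta>"]) (simp_all add: S_dual_iff)
  moreover have "T \<in> extensional (S_space \<theta>)" "T' \<in> extensional (S_space \<theta>)"
    using T T' by (simp_all add: S_operators_def PiE_def)
  ultimately show ?thesis
    using extensionalityI[of T "S_space \<theta>" T'] by simp
qed

section \<open>The spectral integral as an explicit form\<close>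

text \<open>The definite description is resolved by exhibiting \<open>kernel_op\<close> as a
  solution and invoking uniqueness.\<close>

lemma spectral_integral_eq_kernel_op:
  assumes "growth (\<lambda>\<sigma> \<tau>. \<Phi> (spectral_density \<theta> \<pi> \<sigma> \<tau>)) C p"
  shows "spectral_integral \<theta> \<pi> \<Phi> = kernel_op (\<lambda>\<sigma> \<tau>. \<Phi> (spectral_density \<theta> \<pi> \<sigma> \<tau>))"
proof -
  let ?G = "\<lambda>\<sigma> \<tau>. \<Phi> (spectral_density \<theta> \<pi> \<sigma> \<tau>)"
  have fock: "kernel_op ?G (Z \<theta> \<sigma>) (Z \<theta> \<tau>) = ?G \<sigma> \<tau>" if "finite \<sigma>" "finite \<tau>" for \<sigma> \<tau>
    using that by (simp add: kernel_op_def Z_S_space kernel_form_Z)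
  note op = kernel_op_S_operators[OF assms]
  show ?thesis
    unfolding spectral_integral_def fock_transform_def
  proof (rule the_equality)
    show "kernel_op ?G \<in> S_operators \<theta> \<and>
        (\<forall>\<sigma> \<tau>. finite \<sigma> \<longrightarrow> finite \<tau> \<longrightarrow> kernel_op ?G (Z \<theta> \<sigma>) (Z \<theta> \<tau>) = ?G \<sigma> \<tau>)"
      using op fock by simp
  next
    fix T assume T: "T \<in> S_operators \<theta> \<and>
        (\<forall>\<sigma> \<tau>. finite \<sigma> \<longrightarrow> finite \<tau> \<longrightarrow> T (Z \<theta> \<sigma>) (Z \<theta> \<tau>) = ?G \<sigma> \<tau>)"
    show "T = kernel_op ?G"
      by (rule S_operators_eqI) (use T op fock in simp_all)
  qed
qed

section \<open>Positivity of the matrix of spectral densities\<close>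

lemma S_space_integrable:
  assumes "\<xi> \<in> S_space \<theta>"
  shows "integrable (bernoulli \<theta>) \<xi>"
proof -
  have "(\<lambda>\<omega>. 1) \<in> L2 (bernoulli \<theta>)"
    by (simp add: L2_def)
  from L2_integrable_mult[OF this S_space_L2[OF assms]] show ?thesis
    by simp
qed

lemma set_integral_sum_S_space:
  assumes "E \<in> sets (bernoulli \<theta>)" "\<And>i. i \<in> I \<Longrightarrow> f i \<in> S_space \<theta>"
  shows "(LINT \<omega>:E|bernoulli \<theta>. (\<Sum>i\<in>I. c i * f i \<omega>)) = (\<Sum>i\<in>I. c i * (LINT \<omega>:E|bernoulli \<theta>. f i \<omega>))"
proof -
  have int: "integrable (bernoulli \<theta>) (\<lambda>\<omega>. indicator E \<omega> *\<^sub>R f i \<omega>)" if "i \<in> I" for i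
    using assms that by (intro integrable_mult_indicator S_space_integrable)
  have "(LINT \<omega>:E|bernoulli \<theta>. (\<Sum>i\<in>I. c i * f i \<omega>)) =
      (LINT \<omega>|bernoulli \<theta>. (\<Sum>i\<in>I. c i * (indicator E \<omega> *\<^sub>R f i \<omega>)))"
    by (simp add: set_lebesgue_integral_def scaleR_sum_right)
  also have "\<dots> = (\<Sum>i\<in>I. LINT \<omega>|bernoulli \<theta>. c i * (indicator E \<omega> *\<^sub>R f i \<omega>))"
    by (intro Bochner_Integration.integral_sum integrable_mult_right int)
  also have "\<dots> = (\<Sum>i\<in>I. c i * (LINT \<omega>:E|bernoulli \<theta>. f i \<omega>))"
    unfolding set_lebesgue_integral_def by (simp only: integral_mult_right_zero)
  finally show ?thesis .
qed

lemma spectral_density_form_nonneg: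
  assumes \<pi>: "S_smooth \<theta> \<pi>" and \<Phi>: "S_linear \<Phi>" "nonneg_functional \<theta> \<Phi>"
    and F: "F \<subseteq> FS"
  shows "(\<Sum>(\<sigma>, \<tau>)\<in>F \<times> F. cnj (a \<sigma>) * a \<tau> * \<Phi> (spectral_density \<theta> \<pi> \<sigma> \<tau>)) \<in> \<real>\<^sub>\<ge>\<^sub>0"
proof -
  \<comment> \<open>Pairs serve as single indices, so that the rules for finite sums apply over
    \<open>F \<times> F\<close>.\<close>
  let ?\<phi> = "\<lambda>x. spectral_density \<theta> \<pi> (fst x) (snd x)"
  let ?c = "\<lambda>x. cnj (a (fst x)) * a (snd x)"
  define \<psi> where "\<psi> = (\<lambda>\<omega>. \<Sum>x\<in>F \<times> F. ?c x * ?\<phi> x \<omega>)"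
  have dens: "is_spectral_density \<theta> \<pi> (fst x) (snd x) (?\<phi> x)" if "x \<in> F \<times> F" for x
  proof -
    have "finite (fst x)" "finite (snd x)"
      using F that by auto
    then have "\<exists>\<phi>. is_spectral_density \<theta> \<pi> (fst x) (snd x) \<phi>"
      using \<pi> by (simp add: S_smooth_def)
    then show ?thesis
      unfolding spectral_density_def by (rule someI_ex)
  qed
  then have S: "?\<phi> x \<in> S_space \<theta>" if "x \<in> F \<times> F" for x
    using that by (simp add: is_spectral_density_def)
  have \<psi>S: "\<psi> \<in> S_space \<theta>"
    unfolding \<psi>_def by (intro S_space_sum S_space_scale S)
  have "(LINT \<omega>:E|bernoulli \<theta>. \<psi> \<omega>) \<in> \<real>\<^sub>\<ge>\<^sub>0" if E: "E \<in> sets (bernoulli \<theta>)" for E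
  proof -
    have "(LINT \<omega>:E|bernoulli \<theta>. \<psi> \<omega>) = (\<Sum>x\<in>F \<times> F. ?c x * (LINT \<omega>:E|bernoulli \<theta>. ?\<phi> x \<omega>))"
      unfolding \<psi>_def by (intro set_integral_sum_S_space E S)
    also have "\<dots> = (\<Sum>x\<in>F \<times> F. ?c x * ip (bernoulli \<theta>) (\<pi> E (Z \<theta> (fst x))) (Z \<theta> (snd x)))"
      using dens E by (intro sum.cong) (simp_all add: is_spectral_density_def)
    also have "\<dots> = (\<Sum>(\<sigma>, \<tau>)\<in>F \<times> F. cnj (a \<sigma>) * a \<tau> * ip (bernoulli \<theta>) (\<pi> E (Z \<theta> \<sigma>)) (Z \<theta> \<tau>))"
      by (simp add: split_def)
    also have "\<dots> \<in> \<real>\<^sub>\<ge>\<^sub>0"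
    proof (rule orthogonal_projection_sum_nonneg)
      show "orthogonal_projection (bernoulli \<theta>) (\<pi> E)"
        using \<pi> E by (simp add: S_smooth_def spectral_measure_def)
    qed (use F in \<open>auto intro: Z_L2\<close>)
    finally show ?thesis .
  qed
  \<comment> \<open>If the averages of an integrable function over all sets of positive measure lie
    in a closed set, so do almost all of its values.\<close>
  then have "AE \<omega> in bernoulli \<theta>. \<psi> \<omega> \<in> \<real>\<^sub>\<ge>\<^sub>0"
    by (intro averaging_theorem[OF S_space_integrable[OF \<psi>S] closed_nonneg_Reals_complex])
      (simp add: scaleR_conv_of_real nonneg_Reals_mult_I)
  then have "\<Phi> \<psi> \<in> \<real>\<^sub>\<ge>\<^sub>0"
    using \<Phi>(2) \<psi>S by (simp add: nonneg_functional_def nonneg_testfun_def)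
  also have "\<Phi> \<psi> = (\<Sum>x\<in>F \<times> F. ?c x * \<Phi> (?\<phi> x))"
    unfolding \<psi>_def by (intro S_linear_sum \<Phi> S)
  finally show ?thesis
    by (simp add: split_def)
qed

end

theorem theorem4p4:
  fixes \<theta> :: "nat \<Rightarrow> real"
    and \<pi> :: "(nat \<Rightarrow> real) set \<Rightarrow> cfun \<Rightarrow> cfun"
    and \<Phi> :: "cfun \<Rightarrow> complex"
  assumes "\<And>n. 0 < \<theta> n \<and> \<theta> n < 1"
    and "S_smooth \<theta> \<pi>"
    and "\<Phi> \<in> S_dual \<theta>"
    and "spectral_integrable \<theta> \<pi> \<Phi>"
    and "nonneg_functional \<theta> \<Phi>"
  shows "\<forall>\<xi>\<in>S_space \<theta>. spectral_integral \<theta> \<pi> \<Phi> (\<lambda>\<omega>. cnj (\<xi> \<omega>)) \<xi> \<in> \<real>\<^sub>\<ge>\<^sub>0"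
proof
  interpret bernoulli_space \<theta>
    using assms(1) by unfold_locales
  fix \<xi> assume \<xi>: "\<xi> \<in> S_space \<theta>"
  let ?G = "\<lambda>\<sigma> \<tau>. \<Phi> (spectral_density \<theta> \<pi> \<sigma> \<tau>)"
  \<comment> \<open>Integrability with respect to \<open>\<pi>\<close> is precisely the growth
    condition for this matrix.\<close>
  obtain C p where G: "growth ?G C p"
    using assms(4) unfolding spectral_integrable_def growth_def by blast
  have "S_linear \<Phi>"
    using assms(3) by (simp add: S_dual_iff)
  then have "kernel_form ?G (\<lambda>\<omega>. cnj (\<xi> \<omega>)) \<xi> \<in> \<real>\<^sub>\<ge>\<^sub>0"
    using assms(2,5) by (intro kernel_form_cnj_nonneg[OF G \<xi>] spectral_density_form_nonneg)
  \<comment> \<open>\<open>kernel_op\<close> agrees with the form only on test functions, so the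
    conjugate of \<open>\<xi>\<close> has to be recognised as one.\<close>
  then show "spectral_integral \<theta> \<pi> \<Phi> (\<lambda>\<omega>. cnj (\<xi> \<omega>)) \<xi> \<in> \<real>\<^sub>\<ge>\<^sub>0"
    using \<xi> S_space_cnj[OF \<xi>] by (simp add: spectral_integral_eq_kernel_op[OF G] kernel_op_def)
qed

end
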